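(* Let $\mathsf{B}$ be a category with finite products (with chosen terminal object $I_{\mathsf B}$), and let $F\colon \mathsf{B}\to \mathbb{C}\mathsf{at}$ be a pseudofunctor. Then $F$ is canonically endowed with an oplax symmetric monoidal structure $$(F,L,L^1,\omega,\zeta,\xi,\theta)\colon (\mathsf{B},\times,I_{\mathsf{B}})\longrightarrow (\mathbb{C}\mathsf{at},\times,\mathsf{I}),$$ where $L$ has components the functors $L^{A,B}=\langle F(\pi_1),F(\pi_2)\rangle\colon F(A\times B)\to F(A)\times F(B)$, and $L^1$ is the unique functor $F(I_{\mathsf B})\to \mathsf I$.
   Context: $\mathsf B$ is regarded as a locally discrete 2-category, and $\mathbb{C}\mathsf{at}$ is the 2-category of (locally small) categories, both endowed with their cartesian symmetric monoidal structures; $\mathsf I$ is the terminal category with unique object $\star$. A pseudofunctor $(F,\phi,\phi^1)\colon\mathsf B\to\mathbb{C}\mathsf{at}$ is a weak 2-functor, with coherent natural isomorphisms $\phi_{f,g}\colon F(g)\circ F(f)\cong F(g\circ f)$ and $\phi^1_B\colon 1_{F(B)}\cong F(1_B)$. $\pi_1,\pi_2$ denote product projections, $\alpha$ the cartesian associators, $\sigma$ the cartesian symmetries. The functor $L^{A,B}$ is defined by the universal property of products in $\mathbb{C}\mathsf{at}$: $\pi_i\circ L^{A,B}=F(\pi_i)$ for $i=1,2$. For arrows $a\colon A\to A'$, $b\colon B\to B'$ its pseudonaturality isomorphism is the natural isomorphism $L^{(a,b)}\colon L^{A',B'}\circ F(a\times b)\Rightarrow (F(a)\times F(b))\circ L^{A,B}$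 determined by $\pi_i\circ L^{(a,b)}=\iota_i$, where $\iota_1\colon F(\pi_1)\circ F(a\times b)\cong F(a)\circ F(\pi_1)$ and $\iota_2\colon F(\pi_2)\circ F(a\times b)\cong F(b)\circ F(\pi_2)$ are the canonical isomorphisms given by pseudofunctoriality of $F$. An oplax symmetric monoidal structure on $F$ consists of pseudonatural transformations $L\colon F\circ\times\Rightarrow \times\circ(F\times F)$ (components $L^{A,B}\colon F(A\times B)\to F(A)\times F(B)$) and $L^1\colon F(I_{\mathsf B})\to\mathsf I$, together with invertible modifications with components $\omega_{A,B,C}\colon (1\times L^{B,C})\circ L^{A,B\times C}\circ F(\alpha_{A,B,C})\Rightarrow \alpha_{F(A),F(B),F(C)}\circ(L^{A,B}\times 1)\circ L^{A\times B,C}$, $\zeta_A\colon F(\pi_1)\Rightarrow \pi_1\circ(1\times L^1)\circ L^{A,I_{\mathsf B}}$, $\xi_A\colon F(\pi_2)\Rightarrow\pi_2\circ(L^1\times 1)\circ L^{I_{\mathsf B},A}$, $\theta_{A,B}\colon L^{B,A}\circ F(\sigma_{A,B})\Rightarrow \sigma_{F(A),F(B)}\circ L^{A,B}$, satisfying the usual coherence conditions for (op)lax symmetric monoidal homomorphisms between monoidal 2-categories (in the sense of Day–Street). *)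

theory Defs
  imports Main
begin

section \<open>Categories, functors and natural transformations\<close>

record ('o, 'm) cat =
  Obj :: "'o set"
  Arr :: "'m set"
  Dom :: "'m \<Rightarrow> 'o"
  Cod :: "'m \<Rightarrow> 'o"
  Ident :: "'o \<Rightarrow> 'm"
  Comp :: "'m \<Rightarrow> 'm \<Rightarrow> 'm"  (infixr "\<cdot>\<index>" 70)

definition hom :: "('o, 'm, 'z) cat_scheme \<Rightarrow> 'o \<Rightarrow> 'o \<Rightarrow> 'm set" where
  "hom C x y = {f \<in> Arr C. Dom C f = x \<and> Cod C f = y}"

definition category :: "('o, 'm, 'z) cat_scheme \<Rightarrow> bool" where
  "category C \<longleftrightarrow>
     (\<forall>f \<in> Arr C. Dom C f \<in> Obj C \<and> Cod C f \<in> Obj C) \<and>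
     (\<forall>x \<in> Obj C. Ident C x \<in> hom C x x) \<and>
     (\<forall>f \<in> Arr C. \<forall>g \<in> Arr C. Cod C f = Dom C g \<longrightarrow>
        g \<cdot>\<^bsub>C\<^esub> f \<in> hom C (Dom C f) (Cod C g)) \<and>
     (\<forall>f \<in> Arr C. f \<cdot>\<^bsub>C\<^esub> Ident C (Dom C f) = f \<and> Ident C (Cod C f) \<cdot>\<^bsub>C\<^esub> f = f) \<and>
     (\<forall>f \<in> Arr C. \<forall>g \<in> Arr C. \<forall>h \<in> Arr C. Cod C f = Dom C g \<longrightarrow> Cod C g = Dom C h \<longrightarrow>
        (h \<cdot>\<^bsub>C\<^esub> g) \<cdot>\<^bsub>C\<^esub> f = h \<cdot>\<^bsub>C\<^esub> (g \<cdot>\<^bsub>C\<^esub> f))"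

definition is_inverse :: "('o, 'm, 'z) cat_scheme \<Rightarrow> 'm \<Rightarrow> 'm \<Rightarrow> bool" where
  "is_inverse C f g \<longleftrightarrow> g \<in> hom C (Cod C f) (Dom C f) \<and>
     g \<cdot>\<^bsub>C\<^esub> f = Ident C (Dom C f) \<and> f \<cdot>\<^bsub>C\<^esub> g = Ident C (Cod C f)"

definition is_iso :: "('o, 'm, 'z) cat_scheme \<Rightarrow> 'm \<Rightarrow> bool" where
  "is_iso C f \<longleftrightarrow> f \<in> Arr C \<and> (\<exists>g. is_inverse C f g)"

definition inverse_arr :: "('o, 'm, 'z) cat_scheme \<Rightarrow> 'm \<Rightarrow> 'm" where
  "inverse_arr C f = (THE g. is_inverse C f g)"

record ('o, 'm, 'p, 'n) ftor =
  FO :: "'o \<Rightarrow> 'p"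
  FA :: "'m \<Rightarrow> 'n"

definition is_functor ::
  "('o, 'm, 'y) cat_scheme \<Rightarrow> ('p, 'n, 'z) cat_scheme \<Rightarrow> ('o, 'm, 'p, 'n) ftor \<Rightarrow> bool" where
  "is_functor C D T \<longleftrightarrow>
     (\<forall>x \<in> Obj C. FO T x \<in> Obj D) \<and>
     (\<forall>f \<in> Arr C. FA T f \<in> hom D (FO T (Dom C f)) (FO T (Cod C f))) \<and>
     (\<forall>x \<in> Obj C. FA T (Ident C x) = Ident D (FO T x)) \<and>
     (\<forall>f \<in> Arr C. \<forall>g \<in> Arr C. Cod C f = Dom C g \<longrightarrow>
        FA T (g \<cdot>\<^bsub>C\<^esub> f) = FA T g \<cdot>\<^bsub>D\<^esub> FA T f)"

definition id_ftor :: "('o, 'm, 'o, 'm) ftor" where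
  "id_ftor = \<lparr>FO = id, FA = id\<rparr>"

definition comp_ftor ::
  "('p, 'n, 'q, 'k) ftor \<Rightarrow> ('o, 'm, 'p, 'n) ftor \<Rightarrow> ('o, 'm, 'q, 'k) ftor"  (infixr "\<odot>" 80) where
  "S \<odot> T = \<lparr>FO = FO S \<circ> FO T, FA = FA S \<circ> FA T\<rparr>"

text \<open>A 2-cell between functors is the family of its components.  Its source and target functors
  are supplied separately, and its values outside the objects of the domain are irrelevant.\<close>

definition nat_trans ::
  "('o, 'm, 'y) cat_scheme \<Rightarrow> ('p, 'n, 'z) cat_scheme \<Rightarrow>
   ('o, 'm, 'p, 'n) ftor \<Rightarrow> ('o, 'm, 'p, 'n) ftor \<Rightarrow> ('o \<Rightarrow> 'n) \<Rightarrow> bool" where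
  "nat_trans C D S T \<eta> \<longleftrightarrow>
     (\<forall>x \<in> Obj C. \<eta> x \<in> hom D (FO S x) (FO T x)) \<and>
     (\<forall>f \<in> Arr C. \<eta> (Cod C f) \<cdot>\<^bsub>D\<^esub> FA S f = FA T f \<cdot>\<^bsub>D\<^esub> \<eta> (Dom C f))"

definition nat_iso ::
  "('o, 'm, 'y) cat_scheme \<Rightarrow> ('p, 'n, 'z) cat_scheme \<Rightarrow>
   ('o, 'm, 'p, 'n) ftor \<Rightarrow> ('o, 'm, 'p, 'n) ftor \<Rightarrow> ('o \<Rightarrow> 'n) \<Rightarrow> bool" where
  "nat_iso C D S T \<eta> \<longleftrightarrow> nat_trans C D S T \<eta> \<and> (\<forall>x \<in> Obj C. is_iso D (\<eta> x))"

definition cells_eq :: "('o, 'm, 'z) cat_scheme \<Rightarrow> ('o \<Rightarrow> 'n) \<Rightarrow> ('o \<Rightarrow> 'n) \<Rightarrow> bool" where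
  "cells_eq C \<eta> \<epsilon> \<longleftrightarrow> (\<forall>x \<in> Obj C. \<eta> x = \<epsilon> x)"

definition vcomp :: "('p, 'n, 'z) cat_scheme \<Rightarrow> ('o \<Rightarrow> 'n) \<Rightarrow> ('o \<Rightarrow> 'n) \<Rightarrow> 'o \<Rightarrow> 'n"
    (infixr "\<bullet>\<index>" 65) where
  "\<epsilon> \<bullet>\<^bsub>D\<^esub> \<eta> = (\<lambda>x. \<epsilon> x \<cdot>\<^bsub>D\<^esub> \<eta> x)"

definition whisker_left :: "('p, 'n, 'q, 'k) ftor \<Rightarrow> ('o \<Rightarrow> 'n) \<Rightarrow> 'o \<Rightarrow> 'k"  (infixr "\<lhd>" 75) where
  "S \<lhd> \<eta> = (\<lambda>x. FA S (\<eta> x))"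

definition whisker_right :: "('p \<Rightarrow> 'k) \<Rightarrow> ('o, 'm, 'p, 'n) ftor \<Rightarrow> 'o \<Rightarrow> 'k"  (infixl "\<rhd>" 76) where
  "\<eta> \<rhd> T = (\<lambda>x. \<eta> (FO T x))"

definition id_cell :: "('p, 'n, 'z) cat_scheme \<Rightarrow> ('o, 'm, 'p, 'n) ftor \<Rightarrow> 'o \<Rightarrow> 'n" where
  "id_cell D T = (\<lambda>x. Ident D (FO T x))"

definition inverse_cell :: "('p, 'n, 'z) cat_scheme \<Rightarrow> ('o \<Rightarrow> 'n) \<Rightarrow> 'o \<Rightarrow> 'n" where
  "inverse_cell D \<eta> = (\<lambda>x. inverse_arr D (\<eta> x))"


section \<open>The cartesian structure of Cat\<close>

definition prod_cat :: "('o, 'm, 'y) cat_scheme \<Rightarrow> ('p, 'n, 'z) cat_scheme \<Rightarrow> ('o \<times> 'p, 'm \<times> 'n) cat"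
    (infixr "\<times>\<^sub>C" 80) where
  "C \<times>\<^sub>C D = \<lparr>Obj = Obj C \<times> Obj D, Arr = Arr C \<times> Arr D,
     Dom = map_prod (Dom C) (Dom D), Cod = map_prod (Cod C) (Cod D),
     Ident = map_prod (Ident C) (Ident D),
     Comp = (\<lambda>(g, k) (f, h). (g \<cdot>\<^bsub>C\<^esub> f, k \<cdot>\<^bsub>D\<^esub> h))\<rparr>"

definition unit_cat :: "(unit, unit) cat" where
  "unit_cat = \<lparr>Obj = UNIV, Arr = UNIV, Dom = (\<lambda>_. ()), Cod = (\<lambda>_. ()),
     Ident = (\<lambda>_. ()), Comp = (\<lambda>_ _. ())\<rparr>"

definition prod_ftor ::
  "('o, 'm, 'p, 'n) ftor \<Rightarrow> ('o2, 'm2, 'p2, 'n2) ftor \<Rightarrow> ('o \<times> 'o2, 'm \<times> 'm2, 'p \<times> 'p2, 'n \<times> 'n2) ftor"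
    (infixr "\<otimes>" 85) where
  "S \<otimes> T = \<lparr>FO = map_prod (FO S) (FO T), FA = map_prod (FA S) (FA T)\<rparr>"

definition pair_ftor ::
  "('o, 'm, 'p, 'n) ftor \<Rightarrow> ('o, 'm, 'p2, 'n2) ftor \<Rightarrow> ('o, 'm, 'p \<times> 'p2, 'n \<times> 'n2) ftor" where
  "pair_ftor S T = \<lparr>FO = (\<lambda>x. (FO S x, FO T x)), FA = (\<lambda>f. (FA S f, FA T f))\<rparr>"

definition pair_cell :: "('o \<Rightarrow> 'n) \<Rightarrow> ('o \<Rightarrow> 'n2) \<Rightarrow> 'o \<Rightarrow> 'n \<times> 'n2" where
  "pair_cell \<eta> \<epsilon> = (\<lambda>x. (\<eta> x, \<epsilon> x))"

definition prod_cell :: "('o \<Rightarrow> 'n) \<Rightarrow> ('o2 \<Rightarrow> 'n2) \<Rightarrow> 'o \<times> 'o2 \<Rightarrow> 'n \<times> 'n2"  (infixr "\<boxtimes>" 85) where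
  "\<eta> \<boxtimes> \<epsilon> = map_prod \<eta> \<epsilon>"

definition fst_ftor :: "('o \<times> 'p, 'm \<times> 'n, 'o, 'm) ftor" where
  "fst_ftor = \<lparr>FO = fst, FA = fst\<rparr>"

definition snd_ftor :: "('o \<times> 'p, 'm \<times> 'n, 'p, 'n) ftor" where
  "snd_ftor = \<lparr>FO = snd, FA = snd\<rparr>"

definition assoc_ftor ::
  "(('o \<times> 'p) \<times> 'q, ('m \<times> 'n) \<times> 'k, 'o \<times> 'p \<times> 'q, 'm \<times> 'n \<times> 'k) ftor" where
  "assoc_ftor = \<lparr>FO = (\<lambda>((x, y), z). (x, y, z)), FA = (\<lambda>((f, g), h). (f, g, h))\<rparr>"

definition assoc_inv_ftor ::
  "('o \<times> 'p \<times> 'q, 'm \<times> 'n \<times> 'k, ('o \<times> 'p) \<times> 'q, ('m \<times> 'n) \<times> 'k) ftor" where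
  "assoc_inv_ftor = \<lparr>FO = (\<lambda>(x, y, z). ((x, y), z)), FA = (\<lambda>(f, g, h). ((f, g), h))\<rparr>"

definition swap_ftor :: "('o \<times> 'p, 'm \<times> 'n, 'p \<times> 'o, 'n \<times> 'm) ftor" where
  "swap_ftor = \<lparr>FO = prod.swap, FA = prod.swap\<rparr>"

text \<open>Any two functors into the terminal category are equal, so this is the only one.\<close>

definition terminal_ftor :: "('o, 'm, unit, unit) ftor" where
  "terminal_ftor = \<lparr>FO = (\<lambda>_. ()), FA = (\<lambda>_. ())\<rparr>"


section \<open>Categories with chosen finite products\<close>

record ('o, 'm) cart_cat = "('o, 'm) cat" +
  Prod :: "'o \<Rightarrow> 'o \<Rightarrow> 'o"
  P1 :: "'o \<Rightarrow> 'o \<Rightarrow> 'm"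
  P2 :: "'o \<Rightarrow> 'o \<Rightarrow> 'm"
  One :: 'o

definition cartesian :: "('b, 'a, 'z) cart_cat_scheme \<Rightarrow> bool" where
  "cartesian B \<longleftrightarrow> category B \<and>
     (\<forall>X \<in> Obj B. \<forall>Y \<in> Obj B.
        Prod B X Y \<in> Obj B \<and>
        P1 B X Y \<in> hom B (Prod B X Y) X \<and>
        P2 B X Y \<in> hom B (Prod B X Y) Y \<and>
        (\<forall>Z \<in> Obj B. \<forall>f \<in> hom B Z X. \<forall>g \<in> hom B Z Y.
           \<exists>!h. h \<in> hom B Z (Prod B X Y) \<and> P1 B X Y \<cdot>\<^bsub>B\<^esub> h = f \<and> P2 B X Y \<cdot>\<^bsub>B\<^esub> h = g)) \<and>
     One B \<in> Obj B \<and>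
     (\<forall>Z \<in> Obj B. \<exists>!t. t \<in> hom B Z (One B))"

definition tuple :: "('b, 'a, 'z) cart_cat_scheme \<Rightarrow> 'a \<Rightarrow> 'a \<Rightarrow> 'a" where
  "tuple B f g = (THE h. h \<in> hom B (Dom B f) (Prod B (Cod B f) (Cod B g)) \<and>
     P1 B (Cod B f) (Cod B g) \<cdot>\<^bsub>B\<^esub> h = f \<and> P2 B (Cod B f) (Cod B g) \<cdot>\<^bsub>B\<^esub> h = g)"

definition times :: "('b, 'a, 'z) cart_cat_scheme \<Rightarrow> 'a \<Rightarrow> 'a \<Rightarrow> 'a" where
  "times B f g = tuple B (f \<cdot>\<^bsub>B\<^esub> P1 B (Dom B f) (Dom B g)) (g \<cdot>\<^bsub>B\<^esub> P2 B (Dom B f) (Dom B g))"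

definition times_ftor :: "('b, 'a, 'z) cart_cat_scheme \<Rightarrow> ('b \<times> 'b, 'a \<times> 'a, 'b, 'a) ftor" where
  "times_ftor B = \<lparr>FO = (\<lambda>(X, Y). Prod B X Y), FA = (\<lambda>(f, g). times B f g)\<rparr>"

definition assoc :: "('b, 'a, 'z) cart_cat_scheme \<Rightarrow> 'b \<Rightarrow> 'b \<Rightarrow> 'b \<Rightarrow> 'a" where
  "assoc B X Y Z = (let p = P1 B (Prod B X Y) Z; q = P2 B (Prod B X Y) Z in
     tuple B (P1 B X Y \<cdot>\<^bsub>B\<^esub> p) (tuple B (P2 B X Y \<cdot>\<^bsub>B\<^esub> p) q))"

definition assoc_inv :: "('b, 'a, 'z) cart_cat_scheme \<Rightarrow> 'b \<Rightarrow> 'b \<Rightarrow> 'b \<Rightarrow> 'a" where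
  "assoc_inv B X Y Z = (let p = P1 B X (Prod B Y Z); q = P2 B X (Prod B Y Z) in
     tuple B (tuple B p (P1 B Y Z \<cdot>\<^bsub>B\<^esub> q)) (P2 B Y Z \<cdot>\<^bsub>B\<^esub> q))"

definition symm :: "('b, 'a, 'z) cart_cat_scheme \<Rightarrow> 'b \<Rightarrow> 'b \<Rightarrow> 'a" where
  "symm B X Y = tuple B (P2 B X Y) (P1 B X Y)"


section \<open>Pseudofunctors into Cat, pseudonatural transformations, modifications\<close>

text \<open>\<open>PC F f g\<close> is the isomorphism \<open>F g \<circ> F f \<cong> F (g \<circ> f)\<close> and \<open>PU F A\<close> is \<open>1 \<cong> F 1\<close>.
  All the categories \<open>PO F A\<close> use the same types of objects and arrows; since distinct
  \<open>A\<close> may be tagged, every indexed family of categories can be presented in this way.\<close>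

record ('b, 'a, 'o, 'm) psf =
  PO :: "'b \<Rightarrow> ('o, 'm) cat"
  PA :: "'a \<Rightarrow> ('o, 'm, 'o, 'm) ftor"
  PC :: "'a \<Rightarrow> 'a \<Rightarrow> 'o \<Rightarrow> 'm"
  PU :: "'b \<Rightarrow> 'o \<Rightarrow> 'm"

definition pseudofunctor :: "('b, 'a, 'z) cat_scheme \<Rightarrow> ('b, 'a, 'o, 'm) psf \<Rightarrow> bool" where
  "pseudofunctor B F \<longleftrightarrow>
     (\<forall>X \<in> Obj B. category (PO F X)) \<and>
     (\<forall>f \<in> Arr B. is_functor (PO F (Dom B f)) (PO F (Cod B f)) (PA F f)) \<and>
     (\<forall>f \<in> Arr B. \<forall>g \<in> Arr B. Cod B f = Dom B g \<longrightarrow>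
        nat_iso (PO F (Dom B f)) (PO F (Cod B g)) (PA F g \<odot> PA F f) (PA F (g \<cdot>\<^bsub>B\<^esub> f)) (PC F f g)) \<and>
     (\<forall>X \<in> Obj B. nat_iso (PO F X) (PO F X) id_ftor (PA F (Ident B X)) (PU F X)) \<and>
     (\<forall>f \<in> Arr B. \<forall>g \<in> Arr B. \<forall>h \<in> Arr B. Cod B f = Dom B g \<longrightarrow> Cod B g = Dom B h \<longrightarrow>
        (let D = PO F (Cod B h) in
         cells_eq (PO F (Dom B f))
           (PC F (g \<cdot>\<^bsub>B\<^esub> f) h \<bullet>\<^bsub>D\<^esub> PA F h \<lhd> PC F f g)
           (PC F f (h \<cdot>\<^bsub>B\<^esub> g) \<bullet>\<^bsub>D\<^esub> PC F g h \<rhd> PA F f))) \<and>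
     (\<forall>f \<in> Arr B.
        (let D = PO F (Cod B f) in
         cells_eq (PO F (Dom B f))
           (PC F f (Ident B (Cod B f)) \<bullet>\<^bsub>D\<^esub> PU F (Cod B f) \<rhd> PA F f) (id_cell D (PA F f)) \<and>
         cells_eq (PO F (Dom B f))
           (PC F (Ident B (Dom B f)) f \<bullet>\<^bsub>D\<^esub> PA F f \<lhd> PU F (Dom B f)) (id_cell D (PA F f))))"

definition psf_precomp :: "('b, 'a, 'o, 'm) psf \<Rightarrow> ('c, 'u, 'b, 'a) ftor \<Rightarrow> ('c, 'u, 'o, 'm) psf" where
  "psf_precomp F K = \<lparr>PO = (\<lambda>c. PO F (FO K c)), PA = (\<lambda>u. PA F (FA K u)),
     PC = (\<lambda>u v. PC F (FA K u) (FA K v)), PU = (\<lambda>c. PU F (FO K c))\<rparr>"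

text \<open>The pseudofunctor \<open>(X, Y) \<mapsto> F X \<times> G Y\<close>.\<close>

definition psf_prod ::
  "('b, 'a, 'o, 'm) psf \<Rightarrow> ('c, 'u, 'p, 'n) psf \<Rightarrow> ('b \<times> 'c, 'a \<times> 'u, 'o \<times> 'p, 'm \<times> 'n) psf" where
  "psf_prod F G = \<lparr>PO = (\<lambda>(X, Y). PO F X \<times>\<^sub>C PO G Y), PA = (\<lambda>(f, g). PA F f \<otimes> PA G g),
     PC = (\<lambda>(f, g) (f', g'). PC F f f' \<boxtimes> PC G g g'), PU = (\<lambda>(X, Y). PU F X \<boxtimes> PU G Y)\<rparr>"

text \<open>The pseudofunctor constant at the terminal category.\<close>

definition psf_unit :: "('c, 'u, unit, unit) psf" where
  "psf_unit = \<lparr>PO = (\<lambda>_. unit_cat), PA = (\<lambda>_. id_ftor), PC = (\<lambda>_ _ _. ()), PU = (\<lambda>_ _. ())\<rparr>"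

text \<open>The 2-cell of \<open>\<tau> : F \<Rightarrow> G\<close> at \<open>u : X \<rightarrow> X'\<close> is \<open>\<tau>\<^sub>X\<^sub>' \<circ> F u \<Rightarrow> G u \<circ> \<tau>\<^sub>X\<close>.  The domain is
  locally discrete, so no naturality in 2-cells of the domain is needed.\<close>

record ('b, 'a, 'o, 'm, 'p, 'n) pnt =
  Fn :: "'b \<Rightarrow> ('o, 'm, 'p, 'n) ftor"
  Cell :: "'a \<Rightarrow> 'o \<Rightarrow> 'n"

definition pseudonatural ::
  "('b, 'a, 'z) cat_scheme \<Rightarrow> ('b, 'a, 'o, 'm) psf \<Rightarrow> ('b, 'a, 'p, 'n) psf \<Rightarrow>
   ('b, 'a, 'o, 'm, 'p, 'n) pnt \<Rightarrow> bool" where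
  "pseudonatural B F G \<tau> \<longleftrightarrow>
     (\<forall>X \<in> Obj B. is_functor (PO F X) (PO G X) (Fn \<tau> X)) \<and>
     (\<forall>u \<in> Arr B. nat_iso (PO F (Dom B u)) (PO G (Cod B u))
        (Fn \<tau> (Cod B u) \<odot> PA F u) (PA G u \<odot> Fn \<tau> (Dom B u)) (Cell \<tau> u)) \<and>
     (\<forall>X \<in> Obj B. cells_eq (PO F X)
        (Cell \<tau> (Ident B X) \<bullet>\<^bsub>PO G X\<^esub> Fn \<tau> X \<lhd> PU F X)
        (PU G X \<rhd> Fn \<tau> X)) \<and>
     (\<forall>u \<in> Arr B. \<forall>v \<in> Arr B. Cod B u = Dom B v \<longrightarrow>
        (let D = PO G (Cod B v) in
         cells_eq (PO F (Dom B u))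
           (Cell \<tau> (v \<cdot>\<^bsub>B\<^esub> u) \<bullet>\<^bsub>D\<^esub> Fn \<tau> (Cod B v) \<lhd> PC F u v)
           (PC G u v \<rhd> Fn \<tau> (Dom B u) \<bullet>\<^bsub>D\<^esub> PA G v \<lhd> Cell \<tau> u \<bullet>\<^bsub>D\<^esub> Cell \<tau> v \<rhd> PA F u)))"

definition invertible_modification ::
  "('b, 'a, 'z) cat_scheme \<Rightarrow> ('b, 'a, 'o, 'm) psf \<Rightarrow> ('b, 'a, 'p, 'n) psf \<Rightarrow>
   ('b, 'a, 'o, 'm, 'p, 'n) pnt \<Rightarrow> ('b, 'a, 'o, 'm, 'p, 'n) pnt \<Rightarrow> ('b \<Rightarrow> 'o \<Rightarrow> 'n) \<Rightarrow> bool" where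
  "invertible_modification B F G \<sigma> \<tau> m \<longleftrightarrow>
     (\<forall>X \<in> Obj B. nat_iso (PO F X) (PO G X) (Fn \<sigma> X) (Fn \<tau> X) (m X)) \<and>
     (\<forall>u \<in> Arr B.
        (let D = PO G (Cod B u) in
         cells_eq (PO F (Dom B u))
           (PA G u \<lhd> m (Dom B u) \<bullet>\<^bsub>D\<^esub> Cell \<sigma> u)
           (Cell \<tau> u \<bullet>\<^bsub>D\<^esub> m (Cod B u) \<rhd> PA F u)))"

text \<open>\<open>pnt_comp B H \<upsilon> \<tau>\<close> is the composite \<open>F \<Rightarrow> G \<Rightarrow> H\<close> of \<open>\<tau>\<close> followed by \<open>\<upsilon>\<close>.\<close>

definition pnt_comp ::
  "('b, 'a, 'z) cat_scheme \<Rightarrow> ('b, 'a, 'q, 'k) psf \<Rightarrow> ('b, 'a, 'p, 'n, 'q, 'k) pnt \<Rightarrow>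
   ('b, 'a, 'o, 'm, 'p, 'n) pnt \<Rightarrow> ('b, 'a, 'o, 'm, 'q, 'k) pnt" where
  "pnt_comp B H \<upsilon> \<tau> = \<lparr>Fn = (\<lambda>X. Fn \<upsilon> X \<odot> Fn \<tau> X),
     Cell = (\<lambda>u. Cell \<upsilon> u \<rhd> Fn \<tau> (Dom B u) \<bullet>\<^bsub>PO H (Cod B u)\<^esub> Fn \<upsilon> (Cod B u) \<lhd> Cell \<tau> u)\<rparr>"

definition pnt_precomp ::
  "('b, 'a, 'o, 'm, 'p, 'n) pnt \<Rightarrow> ('c, 'u, 'b, 'a) ftor \<Rightarrow> ('c, 'u, 'o, 'm, 'p, 'n) pnt" where
  "pnt_precomp \<tau> K = \<lparr>Fn = (\<lambda>c. Fn \<tau> (FO K c)), Cell = (\<lambda>u. Cell \<tau> (FA K u))\<rparr>"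

definition pnt_prod ::
  "('b, 'a, 'o, 'm, 'p, 'n) pnt \<Rightarrow> ('c, 'u, 'o2, 'm2, 'p2, 'n2) pnt \<Rightarrow>
   ('b \<times> 'c, 'a \<times> 'u, 'o \<times> 'o2, 'm \<times> 'm2, 'p \<times> 'p2, 'n \<times> 'n2) pnt" where
  "pnt_prod \<sigma> \<tau> = \<lparr>Fn = (\<lambda>(X, Y). Fn \<sigma> X \<otimes> Fn \<tau> Y), Cell = (\<lambda>(u, v). Cell \<sigma> u \<boxtimes> Cell \<tau> v)\<rparr>"

text \<open>For functors \<open>T X : F X \<rightarrow> G X\<close> that are natural on the nose: the 2-natural transformation
  with identity 2-cells.\<close>

definition pnt_strict ::
  "('b, 'a, 'z) cat_scheme \<Rightarrow> ('b, 'a, 'p, 'n) psf \<Rightarrow> ('b \<Rightarrow> ('o, 'm, 'p, 'n) ftor) \<Rightarrow>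
   ('b, 'a, 'o, 'm, 'p, 'n) pnt" where
  "pnt_strict B G T = \<lparr>Fn = T, Cell = (\<lambda>u. id_cell (PO G (Cod B u)) (PA G u \<odot> T (Dom B u)))\<rparr>"

definition pnt_id ::
  "('b, 'a, 'z) cat_scheme \<Rightarrow> ('b, 'a, 'o, 'm) psf \<Rightarrow> ('b, 'a, 'o, 'm, 'o, 'm) pnt" where
  "pnt_id B F = pnt_strict B F (\<lambda>_. id_ftor)"

text \<open>The canonical isomorphism \<open>F g \<circ> F f \<cong> F (g \<circ> f) = F (k \<circ> h) \<cong> F k \<circ> F h\<close> of a commutative
  square \<open>g \<circ> f = k \<circ> h\<close>.\<close>

definition psf_square ::
  "('b, 'a, 'z) cat_scheme \<Rightarrow> ('b, 'a, 'o, 'm) psf \<Rightarrow> 'a \<Rightarrow> 'a \<Rightarrow> 'a \<Rightarrow> 'a \<Rightarrow> 'o \<Rightarrow> 'm" where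
  "psf_square B F f g h k =
     (let D = PO F (Cod B g) in inverse_cell D (PC F h k) \<bullet>\<^bsub>D\<^esub> PC F f g)"

text \<open>The canonical isomorphism \<open>F h \<circ> F g \<circ> F f \<cong> F (h \<circ> g \<circ> f)\<close>.\<close>

definition psf_comp3 ::
  "('b, 'a, 'z) cat_scheme \<Rightarrow> ('b, 'a, 'o, 'm) psf \<Rightarrow> 'a \<Rightarrow> 'a \<Rightarrow> 'a \<Rightarrow> 'o \<Rightarrow> 'm" where
  "psf_comp3 B F f g h = PC F (g \<cdot>\<^bsub>B\<^esub> f) h \<bullet>\<^bsub>PO F (Cod B h)\<^esub> PA F h \<lhd> PC F f g"

text \<open>The image under \<open>F\<close> of a natural transformation \<open>a : K \<Rightarrow> K'\<close> between functors
  \<open>K, K' : C \<rightarrow> B\<close>, a pseudonatural transformation \<open>F \<circ> K \<Rightarrow> F \<circ> K'\<close>.\<close>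

definition pnt_image ::
  "('c, 'u, 'y) cat_scheme \<Rightarrow> ('b, 'a, 'z) cat_scheme \<Rightarrow> ('b, 'a, 'o, 'm) psf \<Rightarrow>
   ('c, 'u, 'b, 'a) ftor \<Rightarrow> ('c, 'u, 'b, 'a) ftor \<Rightarrow> ('c \<Rightarrow> 'a) \<Rightarrow> ('c, 'u, 'o, 'm, 'o, 'm) pnt" where
  "pnt_image C B F K K' a = \<lparr>Fn = (\<lambda>c. PA F (a c)),
     Cell = (\<lambda>u. psf_square B F (FA K u) (a (Cod C u)) (a (Dom C u)) (FA K' u))\<rparr>"


section \<open>Oplax symmetric monoidal structures\<close>

text \<open>The source and target of \<open>\<omega>\<close>, as pseudonatural transformations between pseudofunctors on
  \<open>(B \<times> B) \<times> B\<close>, with components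
  \<open>(1 \<times> L) \<circ> L \<circ> F \<alpha>, \<alpha> \<circ> (L \<times> 1) \<circ> L : F ((X \<times> Y) \<times> Z) \<rightarrow> F X \<times> (F Y \<times> F Z)\<close>.\<close>

definition omega_dom ::
  "('b, 'a, 'z) cart_cat_scheme \<Rightarrow> ('b, 'a, 'o, 'm) psf \<Rightarrow>
   (('b \<times> 'b) \<times> 'b, ('a \<times> 'a) \<times> 'a, 'o, 'm) psf" where
  "omega_dom B F = psf_precomp F (times_ftor B \<odot> (times_ftor B \<otimes> id_ftor))"

definition omega_cod ::
  "('b, 'a, 'o, 'm) psf \<Rightarrow> (('b \<times> 'b) \<times> 'b, ('a \<times> 'a) \<times> 'a, 'o \<times> 'o \<times> 'o, 'm \<times> 'm \<times> 'm) psf" where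
  "omega_cod F = psf_precomp (psf_prod F (psf_prod F F)) assoc_ftor"

definition omega_source ::
  "('b, 'a, 'z) cart_cat_scheme \<Rightarrow> ('b, 'a, 'o, 'm) psf \<Rightarrow>
   ('b \<times> 'b, 'a \<times> 'a, 'o, 'm, 'o \<times> 'o, 'm \<times> 'm) pnt \<Rightarrow>
   (('b \<times> 'b) \<times> 'b, ('a \<times> 'a) \<times> 'a, 'o, 'm, 'o \<times> 'o \<times> 'o, 'm \<times> 'm \<times> 'm) pnt" where
  "omega_source B F L =
    (let C = (B \<times>\<^sub>C B) \<times>\<^sub>C B;
         K = times_ftor B \<odot> (times_ftor B \<otimes> id_ftor);
         M = (id_ftor \<otimes> times_ftor B) \<odot> assoc_ftor
     in pnt_comp C (omega_cod F) (pnt_precomp (pnt_prod (pnt_id B F) L) assoc_ftor)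
          (pnt_comp C (psf_precomp (psf_prod F F) M) (pnt_precomp L M)
            (pnt_image C B F K (times_ftor B \<odot> M) (\<lambda>((X, Y), Z). assoc B X Y Z))))"

definition omega_target ::
  "('b, 'a, 'z) cart_cat_scheme \<Rightarrow> ('b, 'a, 'o, 'm) psf \<Rightarrow>
   ('b \<times> 'b, 'a \<times> 'a, 'o, 'm, 'o \<times> 'o, 'm \<times> 'm) pnt \<Rightarrow>
   (('b \<times> 'b) \<times> 'b, ('a \<times> 'a) \<times> 'a, 'o, 'm, 'o \<times> 'o \<times> 'o, 'm \<times> 'm \<times> 'm) pnt" where
  "omega_target B F L =
    (let C = (B \<times>\<^sub>C B) \<times>\<^sub>C B
     in pnt_comp C (omega_cod F) (pnt_strict C (omega_cod F) (\<lambda>_. assoc_ftor))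
          (pnt_comp C (psf_prod (psf_prod F F) F) (pnt_prod L (pnt_id B F))
            (pnt_precomp L (times_ftor B \<otimes> id_ftor))))"

text \<open>\<open>L\<^sup>1\<close> is a pseudonatural transformation between pseudofunctors on the terminal category:
  from the one that picks \<open>F I\<close> to the one that picks the terminal category.\<close>

definition pick_one :: "('b, 'a, 'z) cart_cat_scheme \<Rightarrow> (unit, unit, 'b, 'a) ftor" where
  "pick_one B = \<lparr>FO = (\<lambda>_. One B), FA = (\<lambda>_. Ident B (One B))\<rparr>"

definition with_one :: "('b, 'a, 'z) cart_cat_scheme \<Rightarrow> ('b, 'a, 'b \<times> 'b, 'a \<times> 'a) ftor" where
  "with_one B = pair_ftor id_ftor (pick_one B \<odot> terminal_ftor)"

definition one_with :: "('b, 'a, 'z) cart_cat_scheme \<Rightarrow> ('b, 'a, 'b \<times> 'b, 'a \<times> 'a) ftor" where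
  "one_with B = pair_ftor (pick_one B \<odot> terminal_ftor) id_ftor"

text \<open>The source and target of \<open>\<zeta>\<close>, with components
  \<open>F \<pi>\<^sub>1, \<pi>\<^sub>1 \<circ> (1 \<times> L\<^sup>1) \<circ> L : F (X \<times> I) \<rightarrow> F X\<close>.\<close>

definition zeta_dom ::
  "('b, 'a, 'z) cart_cat_scheme \<Rightarrow> ('b, 'a, 'o, 'm) psf \<Rightarrow> ('b, 'a, 'o, 'm) psf" where
  "zeta_dom B F = psf_precomp F (times_ftor B \<odot> with_one B)"

definition zeta_source ::
  "('b, 'a, 'z) cart_cat_scheme \<Rightarrow> ('b, 'a, 'o, 'm) psf \<Rightarrow> ('b, 'a, 'o, 'm, 'o, 'm) pnt" where
  "zeta_source B F =
     pnt_image B B F (times_ftor B \<odot> with_one B) id_ftor (\<lambda>X. P1 B X (One B))"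

definition zeta_target ::
  "('b, 'a, 'z) cart_cat_scheme \<Rightarrow> ('b, 'a, 'o, 'm) psf \<Rightarrow>
   ('b \<times> 'b, 'a \<times> 'a, 'o, 'm, 'o \<times> 'o, 'm \<times> 'm) pnt \<Rightarrow> (unit, unit, 'o, 'm, unit, unit) pnt \<Rightarrow>
   ('b, 'a, 'o, 'm, 'o, 'm) pnt" where
  "zeta_target B F L L1 =
    (let J = pair_ftor id_ftor terminal_ftor
     in pnt_comp B F (pnt_strict B F (\<lambda>_. fst_ftor))
          (pnt_comp B (psf_precomp (psf_prod F psf_unit) J)
            (pnt_precomp (pnt_prod (pnt_id B F) L1) J)
            (pnt_precomp L (with_one B))))"

text \<open>The source and target of \<open>\<xi>\<close>, with components
  \<open>F \<pi>\<^sub>2, \<pi>\<^sub>2 \<circ> (L\<^sup>1 \<times> 1) \<circ> L : F (I \<times> X) \<rightarrow> F X\<close>.\<close>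

definition xi_dom ::
  "('b, 'a, 'z) cart_cat_scheme \<Rightarrow> ('b, 'a, 'o, 'm) psf \<Rightarrow> ('b, 'a, 'o, 'm) psf" where
  "xi_dom B F = psf_precomp F (times_ftor B \<odot> one_with B)"

definition xi_source ::
  "('b, 'a, 'z) cart_cat_scheme \<Rightarrow> ('b, 'a, 'o, 'm) psf \<Rightarrow> ('b, 'a, 'o, 'm, 'o, 'm) pnt" where
  "xi_source B F =
     pnt_image B B F (times_ftor B \<odot> one_with B) id_ftor (\<lambda>X. P2 B (One B) X)"

definition xi_target ::
  "('b, 'a, 'z) cart_cat_scheme \<Rightarrow> ('b, 'a, 'o, 'm) psf \<Rightarrow>
   ('b \<times> 'b, 'a \<times> 'a, 'o, 'm, 'o \<times> 'o, 'm \<times> 'm) pnt \<Rightarrow> (unit, unit, 'o, 'm, unit, unit) pnt \<Rightarrow>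
   ('b, 'a, 'o, 'm, 'o, 'm) pnt" where
  "xi_target B F L L1 =
    (let J = pair_ftor terminal_ftor id_ftor
     in pnt_comp B F (pnt_strict B F (\<lambda>_. snd_ftor))
          (pnt_comp B (psf_precomp (psf_prod psf_unit F) J)
            (pnt_precomp (pnt_prod L1 (pnt_id B F)) J)
            (pnt_precomp L (one_with B))))"

text \<open>The source and target of \<open>\<theta>\<close>, with components
  \<open>L \<circ> F \<sigma>, \<sigma> \<circ> L : F (X \<times> Y) \<rightarrow> F Y \<times> F X\<close>.\<close>

definition theta_cod ::
  "('b, 'a, 'o, 'm) psf \<Rightarrow> ('b \<times> 'b, 'a \<times> 'a, 'o \<times> 'o, 'm \<times> 'm) psf" where
  "theta_cod F = psf_precomp (psf_prod F F) swap_ftor"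

definition theta_source ::
  "('b, 'a, 'z) cart_cat_scheme \<Rightarrow> ('b, 'a, 'o, 'm) psf \<Rightarrow>
   ('b \<times> 'b, 'a \<times> 'a, 'o, 'm, 'o \<times> 'o, 'm \<times> 'm) pnt \<Rightarrow>
   ('b \<times> 'b, 'a \<times> 'a, 'o, 'm, 'o \<times> 'o, 'm \<times> 'm) pnt" where
  "theta_source B F L =
    (let C = B \<times>\<^sub>C B
     in pnt_comp C (theta_cod F) (pnt_precomp L swap_ftor)
          (pnt_image C B F (times_ftor B) (times_ftor B \<odot> swap_ftor) (\<lambda>(X, Y). symm B X Y)))"

definition theta_target ::
  "('b, 'a, 'z) cart_cat_scheme \<Rightarrow> ('b, 'a, 'o, 'm) psf \<Rightarrow>
   ('b \<times> 'b, 'a \<times> 'a, 'o, 'm, 'o \<times> 'o, 'm \<times> 'm) pnt \<Rightarrow>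
   ('b \<times> 'b, 'a \<times> 'a, 'o, 'm, 'o \<times> 'o, 'm \<times> 'm) pnt" where
  "theta_target B F L =
    (let C = B \<times>\<^sub>C B
     in pnt_comp C (theta_cod F) (pnt_strict C (theta_cod F) (\<lambda>_. swap_ftor)) L)"

text \<open>The 2-cells \<open>L \<circ> F (1 \<times> v) \<Rightarrow> (1 \<times> F v) \<circ> L\<close> and \<open>L \<circ> F (u \<times> 1) \<Rightarrow> (F u \<times> 1) \<circ> L\<close>.\<close>

definition cell_r ::
  "('b, 'a, 'z) cart_cat_scheme \<Rightarrow> ('b, 'a, 'o, 'm) psf \<Rightarrow>
   ('b \<times> 'b, 'a \<times> 'a, 'o, 'm, 'o \<times> 'o, 'm \<times> 'm) pnt \<Rightarrow> 'b \<Rightarrow> 'a \<Rightarrow> 'o \<Rightarrow> 'm \<times> 'm" where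
  "cell_r B F L X v =
    (let D = PO F X \<times>\<^sub>C PO F (Cod B v)
     in (inverse_cell (PO F X) (PU F X) \<boxtimes> id_cell (PO F (Cod B v)) (PA F v)) \<rhd> Fn L (X, Dom B v)
        \<bullet>\<^bsub>D\<^esub> Cell L (Ident B X, v))"

definition cell_l ::
  "('b, 'a, 'z) cart_cat_scheme \<Rightarrow> ('b, 'a, 'o, 'm) psf \<Rightarrow>
   ('b \<times> 'b, 'a \<times> 'a, 'o, 'm, 'o \<times> 'o, 'm \<times> 'm) pnt \<Rightarrow> 'a \<Rightarrow> 'b \<Rightarrow> 'o \<Rightarrow> 'm \<times> 'm" where
  "cell_l B F L u Y =
    (let D = PO F (Cod B u) \<times>\<^sub>C PO F Y
     in (id_cell (PO F (Cod B u)) (PA F u) \<boxtimes> inverse_cell (PO F Y) (PU F Y)) \<rhd> Fn L (Dom B u, Y)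
        \<bullet>\<^bsub>D\<^esub> Cell L (u, Ident B Y))"

text \<open>The coherence axioms are those of a symmetric weak monoidal homomorphism in the sense of
  Day and Street, with the 1-cells \<open>L\<close>, \<open>L\<^sup>1\<close> in the oplax direction.  In both \<open>B\<close> and Cat
  the pentagon, triangle and hexagons of the cartesian constraints commute strictly, and so do the
  naturality squares of those constraints in Cat; the corresponding structural 2-cells are therefore
  identities and do not appear.  Each axiom equates two pastings, written as vertical composites
  to be read from bottom to top.\<close>

text \<open>The associativity axiom: 2-cells
  \<open>(1 \<times> (1 \<times> L)) \<circ> (1 \<times> L) \<circ> L \<circ> F \<alpha> \<circ> F \<alpha> \<Rightarrow> \<alpha> \<circ> \<alpha> \<circ> ((L \<times> 1) \<times> 1) \<circ> (L \<times> 1) \<circ> L\<close>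
  between functors \<open>F (((X \<times> Y) \<times> Z) \<times> W) \<rightarrow> F X \<times> (F Y \<times> (F Z \<times> F W))\<close>.\<close>

definition axiom_assoc ::
  "('b, 'a, 'z) cart_cat_scheme \<Rightarrow> ('b, 'a, 'o, 'm) psf \<Rightarrow>
   ('b \<times> 'b, 'a \<times> 'a, 'o, 'm, 'o \<times> 'o, 'm \<times> 'm) pnt \<Rightarrow> (('b \<times> 'b) \<times> 'b \<Rightarrow> 'o \<Rightarrow> 'm \<times> 'm \<times> 'm) \<Rightarrow> bool" where
  "axiom_assoc B F L \<omega> \<longleftrightarrow>
    (\<forall>X \<in> Obj B. \<forall>Y \<in> Obj B. \<forall>Z \<in> Obj B. \<forall>W \<in> Obj B.
      (let i = (id_ftor :: ('o, 'm, 'o, 'm) ftor);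
           \<alpha> = (assoc_ftor :: (('o \<times> 'o) \<times> 'o, ('m \<times> 'm) \<times> 'm, 'o \<times> 'o \<times> 'o, 'm \<times> 'm \<times> 'm) ftor);
           E = PO F (Prod B (Prod B (Prod B X Y) Z) W);
           D = PO F X \<times>\<^sub>C (PO F Y \<times>\<^sub>C (PO F Z \<times>\<^sub>C PO F W));
           l = (\<lambda>U V. Fn L (U, V));
           XY = Prod B X Y; YZ = Prod B Y Z; ZW = Prod B Z W;
           a1 = times B (assoc B X Y Z) (Ident B W);
           a2 = assoc B X YZ W;
           a3 = times B (Ident B X) (assoc B Y Z W);
           b1 = assoc B XY Z W;
           b2 = assoc B X Y ZW
       in cells_eq E
         ((assoc_ftor \<odot> (l X Y \<otimes> (i \<otimes> i))) \<lhd> \<omega> ((XY, Z), W) \<bullet>\<^bsub>D\<^esub>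
          (i \<otimes> (i \<otimes> l Z W)) \<lhd> \<omega> ((X, Y), ZW) \<rhd> PA F b1)
         (((i \<otimes> \<alpha>) \<odot> assoc_ftor)
            \<lhd> (\<omega> ((X, Y), Z) \<boxtimes> Ident (PO F W)) \<rhd> l (Prod B XY Z) W \<bullet>\<^bsub>D\<^esub>
          ((i \<otimes> \<alpha>) \<odot> (i \<otimes> (l Y Z \<otimes> i)) \<odot> assoc_ftor \<odot> (l X YZ \<otimes> i))
            \<lhd> cell_l B F L (assoc B X Y Z) W \<bullet>\<^bsub>D\<^esub>
          ((i \<otimes> \<alpha>) \<odot> (i \<otimes> (l Y Z \<otimes> i)))
            \<lhd> \<omega> ((X, YZ), W) \<rhd> PA F a1 \<bullet>\<^bsub>D\<^esub>
          (Ident (PO F X) \<boxtimes> \<omega> ((Y, Z), W))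
            \<rhd> (l X (Prod B YZ W) \<odot> PA F a2 \<odot> PA F a1) \<bullet>\<^bsub>D\<^esub>
          ((i \<otimes> (i \<otimes> l Z W)) \<odot> (i \<otimes> l Y ZW))
            \<lhd> cell_r B F L X (assoc B Y Z W) \<rhd> (PA F a2 \<odot> PA F a1) \<bullet>\<^bsub>D\<^esub>
          ((i \<otimes> (i \<otimes> l Z W)) \<odot> (i \<otimes> l Y ZW) \<odot> l X (Prod B Y ZW))
            \<lhd> (inverse_cell (PO F (Prod B X (Prod B Y ZW))) (psf_comp3 B F a1 a2 a3)
               \<bullet>\<^bsub>PO F (Prod B X (Prod B Y ZW))\<^esub> PC F b1 b2))))"

text \<open>The unit axiom: 2-cells
  \<open>L \<circ> F (\<pi>\<^sub>1 \<times> 1) \<Rightarrow> (\<pi>\<^sub>1 \<times> 1) \<circ> ((1 \<times> L\<^sup>1) \<times> 1) \<circ> (L \<times> 1) \<circ> L\<close>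
  between functors \<open>F ((X \<times> I) \<times> Y) \<rightarrow> F X \<times> F Y\<close>.\<close>

definition axiom_unit ::
  "('b, 'a, 'z) cart_cat_scheme \<Rightarrow> ('b, 'a, 'o, 'm) psf \<Rightarrow>
   ('b \<times> 'b, 'a \<times> 'a, 'o, 'm, 'o \<times> 'o, 'm \<times> 'm) pnt \<Rightarrow> (unit, unit, 'o, 'm, unit, unit) pnt \<Rightarrow>
   (('b \<times> 'b) \<times> 'b \<Rightarrow> 'o \<Rightarrow> 'm \<times> 'm \<times> 'm) \<Rightarrow> ('b \<Rightarrow> 'o \<Rightarrow> 'm) \<Rightarrow> ('b \<Rightarrow> 'o \<Rightarrow> 'm) \<Rightarrow> bool" where
  "axiom_unit B F L L1 \<omega> \<zeta> \<xi> \<longleftrightarrow>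
    (\<forall>X \<in> Obj B. \<forall>Y \<in> Obj B.
      (let i = (id_ftor :: ('o, 'm, 'o, 'm) ftor);
           I = One B;
           E = PO F (Prod B (Prod B X I) Y);
           D = PO F X \<times>\<^sub>C PO F Y;
           l = (\<lambda>U V. Fn L (U, V)); l1 = Fn L1 ();
           a = assoc B X I Y;
           p = times B (Ident B X) (P2 B I Y)
       in cells_eq E
         ((\<zeta> X \<boxtimes> Ident (PO F Y)) \<rhd> l (Prod B X I) Y \<bullet>\<^bsub>D\<^esub>
          cell_l B F L (P1 B X I) Y)
         ((i \<otimes> (snd_ftor \<odot> (l1 \<otimes> i))) \<lhd> \<omega> ((X, I), Y) \<bullet>\<^bsub>D\<^esub>
          (Ident (PO F X) \<boxtimes> \<xi> Y) \<rhd> (l X (Prod B I Y) \<odot> PA F a) \<bullet>\<^bsub>D\<^esub>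
          cell_r B F L X (P2 B I Y) \<rhd> PA F a \<bullet>\<^bsub>D\<^esub>
          l X Y \<lhd> inverse_cell (PO F (Prod B X Y)) (PC F a p))))"

text \<open>The first braiding axiom: 2-cells
  \<open>(1 \<times> L) \<circ> L \<circ> F \<alpha> \<circ> F \<sigma> \<circ> F \<alpha> \<Rightarrow> \<alpha> \<circ> \<sigma> \<circ> \<alpha> \<circ> (L \<times> 1) \<circ> L\<close>
  between functors \<open>F ((X \<times> Y) \<times> Z) \<rightarrow> F Y \<times> (F Z \<times> F X)\<close>.\<close>

definition axiom_braid1 ::
  "('b, 'a, 'z) cart_cat_scheme \<Rightarrow> ('b, 'a, 'o, 'm) psf \<Rightarrow>
   ('b \<times> 'b, 'a \<times> 'a, 'o, 'm, 'o \<times> 'o, 'm \<times> 'm) pnt \<Rightarrow> (('b \<times> 'b) \<times> 'b \<Rightarrow> 'o \<Rightarrow> 'm \<times> 'm \<times> 'm) \<Rightarrow>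
   ('b \<times> 'b \<Rightarrow> 'o \<Rightarrow> 'm \<times> 'm) \<Rightarrow> bool" where
  "axiom_braid1 B F L \<omega> \<theta> \<longleftrightarrow>
    (\<forall>X \<in> Obj B. \<forall>Y \<in> Obj B. \<forall>Z \<in> Obj B.
      (let i = (id_ftor :: ('o, 'm, 'o, 'm) ftor);
           \<alpha> = (assoc_ftor :: (('o \<times> 'o) \<times> 'o, ('m \<times> 'm) \<times> 'm, 'o \<times> 'o \<times> 'o, 'm \<times> 'm \<times> 'm) ftor);
           \<sigma> = (swap_ftor :: ('o \<times> 'o, 'm \<times> 'm, 'o \<times> 'o, 'm \<times> 'm) ftor);
           E = PO F (Prod B (Prod B X Y) Z);
           H = PO F (Prod B Y (Prod B Z X));
           D = PO F Y \<times>\<^sub>C (PO F Z \<times>\<^sub>C PO F X);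
           l = (\<lambda>U V. Fn L (U, V));
           YZ = Prod B Y Z; ZX = Prod B Z X; XZ = Prod B X Z;
           a1 = assoc B X Y Z; a2 = symm B X YZ; a3 = assoc B Y Z X;
           b1 = times B (symm B X Y) (Ident B Z);
           b2 = assoc B Y X Z;
           b3 = times B (Ident B Y) (symm B X Z)
       in cells_eq E
         ((\<alpha> \<odot> swap_ftor) \<lhd> \<omega> ((X, Y), Z) \<bullet>\<^bsub>D\<^esub>
          (assoc_ftor \<odot> (l Y Z \<otimes> i)) \<lhd> \<theta> (X, YZ) \<rhd> PA F a1 \<bullet>\<^bsub>D\<^esub>
          \<omega> ((Y, Z), X) \<rhd> (PA F a2 \<odot> PA F a1))
         (((i \<otimes> \<sigma>) \<odot> assoc_ftor)
            \<lhd> (\<theta> (X, Y) \<boxtimes> Ident (PO F Z)) \<rhd> l (Prod B X Y) Z \<bullet>\<^bsub>D\<^esub>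
          ((i \<otimes> \<sigma>) \<odot> assoc_ftor \<odot> (l Y X \<otimes> i))
            \<lhd> cell_l B F L (symm B X Y) Z \<bullet>\<^bsub>D\<^esub>
          (i \<otimes> \<sigma>) \<lhd> \<omega> ((Y, X), Z) \<rhd> PA F b1 \<bullet>\<^bsub>D\<^esub>
          (Ident (PO F Y) \<boxtimes> \<theta> (X, Z)) \<rhd> (l Y XZ \<odot> PA F b2 \<odot> PA F b1) \<bullet>\<^bsub>D\<^esub>
          (i \<otimes> l Z X) \<lhd> cell_r B F L Y (symm B X Z) \<rhd> (PA F b2 \<odot> PA F b1) \<bullet>\<^bsub>D\<^esub>
          ((i \<otimes> l Z X) \<odot> l Y ZX)
            \<lhd> (inverse_cell H (psf_comp3 B F b1 b2 b3) \<bullet>\<^bsub>H\<^esub> psf_comp3 B F a1 a2 a3))))"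

text \<open>The mate of \<open>\<omega>\<close>, with components
  \<open>(L \<times> 1) \<circ> L \<circ> F \<alpha>\<^sup>-\<^sup>1 \<Rightarrow> \<alpha>\<^sup>-\<^sup>1 \<circ> (1 \<times> L) \<circ> L\<close>.\<close>

definition omega_mate ::
  "('b, 'a, 'z) cart_cat_scheme \<Rightarrow> ('b, 'a, 'o, 'm) psf \<Rightarrow>
   ('b \<times> 'b, 'a \<times> 'a, 'o, 'm, 'o \<times> 'o, 'm \<times> 'm) pnt \<Rightarrow> (('b \<times> 'b) \<times> 'b \<Rightarrow> 'o \<Rightarrow> 'm \<times> 'm \<times> 'm) \<Rightarrow>
   'b \<Rightarrow> 'b \<Rightarrow> 'b \<Rightarrow> 'o \<Rightarrow> ('m \<times> 'm) \<times> 'm" where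
  "omega_mate B F L \<omega> X Y Z =
    (let i = (id_ftor :: ('o, 'm, 'o, 'm) ftor);
         \<alpha>' = (assoc_inv_ftor :: ('o \<times> 'o \<times> 'o, 'm \<times> 'm \<times> 'm, ('o \<times> 'o) \<times> 'o, ('m \<times> 'm) \<times> 'm) ftor);
         D = (PO F X \<times>\<^sub>C PO F Y) \<times>\<^sub>C PO F Z;
         D' = PO F X \<times>\<^sub>C (PO F Y \<times>\<^sub>C PO F Z);
         H = PO F (Prod B X (Prod B Y Z))
     in (\<alpha>' \<odot> (i \<otimes> Fn L (Y, Z)) \<odot> Fn L (X, Prod B Y Z))
          \<lhd> (inverse_cell H (PU F (Prod B X (Prod B Y Z)))
             \<bullet>\<^bsub>H\<^esub> PC F (assoc_inv B X Y Z) (assoc B X Y Z)) \<bullet>\<^bsub>D\<^esub>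
        \<alpha>' \<lhd> inverse_cell D' (\<omega> ((X, Y), Z)) \<rhd> PA F (assoc_inv B X Y Z))"

text \<open>The second braiding axiom: 2-cells
  \<open>(L \<times> 1) \<circ> L \<circ> F \<alpha>\<^sup>-\<^sup>1 \<circ> F \<sigma> \<circ> F \<alpha>\<^sup>-\<^sup>1 \<Rightarrow> \<alpha>\<^sup>-\<^sup>1 \<circ> \<sigma> \<circ> \<alpha>\<^sup>-\<^sup>1 \<circ> (1 \<times> L) \<circ> L\<close>
  between functors \<open>F (X \<times> (Y \<times> Z)) \<rightarrow> (F Z \<times> F X) \<times> F Y\<close>.\<close>

definition axiom_braid2 ::
  "('b, 'a, 'z) cart_cat_scheme \<Rightarrow> ('b, 'a, 'o, 'm) psf \<Rightarrow>
   ('b \<times> 'b, 'a \<times> 'a, 'o, 'm, 'o \<times> 'o, 'm \<times> 'm) pnt \<Rightarrow> (('b \<times> 'b) \<times> 'b \<Rightarrow> 'o \<Rightarrow> 'm \<times> 'm \<times> 'm) \<Rightarrow>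
   ('b \<times> 'b \<Rightarrow> 'o \<Rightarrow> 'm \<times> 'm) \<Rightarrow> bool" where
  "axiom_braid2 B F L \<omega> \<theta> \<longleftrightarrow>
    (\<forall>X \<in> Obj B. \<forall>Y \<in> Obj B. \<forall>Z \<in> Obj B.
      (let i = (id_ftor :: ('o, 'm, 'o, 'm) ftor);
           \<alpha>' = (assoc_inv_ftor :: ('o \<times> 'o \<times> 'o, 'm \<times> 'm \<times> 'm, ('o \<times> 'o) \<times> 'o, ('m \<times> 'm) \<times> 'm) ftor);
           \<sigma> = (swap_ftor :: ('o \<times> 'o, 'm \<times> 'm, 'o \<times> 'o, 'm \<times> 'm) ftor);
           E = PO F (Prod B X (Prod B Y Z));
           H = PO F (Prod B (Prod B Z X) Y);
           D = (PO F Z \<times>\<^sub>C PO F X) \<times>\<^sub>C PO F Y;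
           l = (\<lambda>U V. Fn L (U, V));
           m = omega_mate B F L \<omega>;
           XY = Prod B X Y; ZX = Prod B Z X; XZ = Prod B X Z;
           a1 = assoc_inv B X Y Z; a2 = symm B XY Z; a3 = assoc_inv B Z X Y;
           b1 = times B (Ident B X) (symm B Y Z);
           b2 = assoc_inv B X Z Y;
           b3 = times B (symm B X Z) (Ident B Y)
       in cells_eq E
         ((\<alpha>' \<odot> swap_ftor) \<lhd> m X Y Z \<bullet>\<^bsub>D\<^esub>
          (\<alpha>' \<odot> (i \<otimes> l X Y)) \<lhd> \<theta> (XY, Z) \<rhd> PA F a1 \<bullet>\<^bsub>D\<^esub>
          m Z X Y \<rhd> (PA F a2 \<odot> PA F a1))
         (((\<sigma> \<otimes> i) \<odot> \<alpha>')
            \<lhd> (Ident (PO F X) \<boxtimes> \<theta> (Y, Z)) \<rhd> l X (Prod B Y Z) \<bullet>\<^bsub>D\<^esub>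
          ((\<sigma> \<otimes> i) \<odot> \<alpha>' \<odot> (i \<otimes> l Z Y))
            \<lhd> cell_r B F L X (symm B Y Z) \<bullet>\<^bsub>D\<^esub>
          (\<sigma> \<otimes> i) \<lhd> m X Z Y \<rhd> PA F b1 \<bullet>\<^bsub>D\<^esub>
          (\<theta> (X, Z) \<boxtimes> Ident (PO F Y)) \<rhd> (l XZ Y \<odot> PA F b2 \<odot> PA F b1) \<bullet>\<^bsub>D\<^esub>
          (l Z X \<otimes> i) \<lhd> cell_l B F L (symm B X Z) Y \<rhd> (PA F b2 \<odot> PA F b1) \<bullet>\<^bsub>D\<^esub>
          ((l Z X \<otimes> i) \<odot> l ZX Y)
            \<lhd> (inverse_cell H (psf_comp3 B F b1 b2 b3) \<bullet>\<^bsub>H\<^esub> psf_comp3 B F a1 a2 a3))))"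

text \<open>The symmetry axiom: 2-cells \<open>L \<circ> F \<sigma> \<circ> F \<sigma> \<Rightarrow> L\<close> between functors
  \<open>F (X \<times> Y) \<rightarrow> F X \<times> F Y\<close>.\<close>

definition axiom_symm ::
  "('b, 'a, 'z) cart_cat_scheme \<Rightarrow> ('b, 'a, 'o, 'm) psf \<Rightarrow>
   ('b \<times> 'b, 'a \<times> 'a, 'o, 'm, 'o \<times> 'o, 'm \<times> 'm) pnt \<Rightarrow> ('b \<times> 'b \<Rightarrow> 'o \<Rightarrow> 'm \<times> 'm) \<Rightarrow> bool" where
  "axiom_symm B F L \<theta> \<longleftrightarrow>
    (\<forall>X \<in> Obj B. \<forall>Y \<in> Obj B.
      (let \<sigma> = (swap_ftor :: ('o \<times> 'o, 'm \<times> 'm, 'o \<times> 'o, 'm \<times> 'm) ftor);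
           E = PO F (Prod B X Y);
           D = PO F X \<times>\<^sub>C PO F Y
       in cells_eq E
         (\<sigma> \<lhd> \<theta> (X, Y) \<bullet>\<^bsub>D\<^esub> \<theta> (Y, X) \<rhd> PA F (symm B X Y))
         (Fn L (X, Y) \<lhd> (inverse_cell E (PU F (Prod B X Y))
            \<bullet>\<^bsub>E\<^esub> PC F (symm B X Y) (symm B Y X)))))"

definition oplax_symmetric_monoidal ::
  "('b, 'a, 'z) cart_cat_scheme \<Rightarrow> ('b, 'a, 'o, 'm) psf \<Rightarrow>
   ('b \<times> 'b, 'a \<times> 'a, 'o, 'm, 'o \<times> 'o, 'm \<times> 'm) pnt \<Rightarrow>
   (unit, unit, 'o, 'm, unit, unit) pnt \<Rightarrow>
   (('b \<times> 'b) \<times> 'b \<Rightarrow> 'o \<Rightarrow> 'm \<times> 'm \<times> 'm) \<Rightarrow>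
   ('b \<Rightarrow> 'o \<Rightarrow> 'm) \<Rightarrow> ('b \<Rightarrow> 'o \<Rightarrow> 'm) \<Rightarrow> ('b \<times> 'b \<Rightarrow> 'o \<Rightarrow> 'm \<times> 'm) \<Rightarrow> bool" where
  "oplax_symmetric_monoidal B F L L1 \<omega> \<zeta> \<xi> \<theta> \<longleftrightarrow>
     pseudonatural (B \<times>\<^sub>C B) (psf_precomp F (times_ftor B)) (psf_prod F F) L \<and>
     pseudonatural unit_cat (psf_precomp F (pick_one B)) psf_unit L1 \<and>
     invertible_modification ((B \<times>\<^sub>C B) \<times>\<^sub>C B) (omega_dom B F) (omega_cod F)
       (omega_source B F L) (omega_target B F L) \<omega> \<and>
     invertible_modification B (zeta_dom B F) F (zeta_source B F) (zeta_target B F L L1) \<zeta> \<and>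
     invertible_modification B (xi_dom B F) F (xi_source B F) (xi_target B F L L1) \<xi> \<and>
     invertible_modification (B \<times>\<^sub>C B) (psf_precomp F (times_ftor B)) (theta_cod F)
       (theta_source B F L) (theta_target B F L) \<theta> \<and>
     axiom_assoc B F L \<omega> \<and>
     axiom_unit B F L L1 \<omega> \<zeta> \<xi> \<and>
     axiom_braid1 B F L \<omega> \<theta> \<and>
     axiom_braid2 B F L \<omega> \<theta> \<and>
     axiom_symm B F L \<theta>"


section \<open>The canonical data\<close>

text \<open>\<open>L\<^sup>X\<^sup>,\<^sup>Y = \<langle>F \<pi>\<^sub>1, F \<pi>\<^sub>2\<rangle>\<close>; the 2-cell at \<open>(u, v)\<close> is the one whose projections are the
  canonical isomorphisms \<open>F \<pi>\<^sub>1 \<circ> F (u \<times> v) \<cong> F u \<circ> F \<pi>\<^sub>1\<close> and \<open>F \<pi>\<^sub>2 \<circ> F (u \<times> v) \<cong> F v \<circ> F \<pi>\<^sub>2\<close>.\<close>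

definition canonical_L ::
  "('b, 'a, 'z) cart_cat_scheme \<Rightarrow> ('b, 'a, 'o, 'm) psf \<Rightarrow>
   ('b \<times> 'b, 'a \<times> 'a, 'o, 'm, 'o \<times> 'o, 'm \<times> 'm) pnt" where
  "canonical_L B F = \<lparr>
     Fn = (\<lambda>(X, Y). pair_ftor (PA F (P1 B X Y)) (PA F (P2 B X Y))),
     Cell = (\<lambda>(u, v). pair_cell
       (psf_square B F (times B u v) (P1 B (Cod B u) (Cod B v)) (P1 B (Dom B u) (Dom B v)) u)
       (psf_square B F (times B u v) (P2 B (Cod B u) (Cod B v)) (P2 B (Dom B u) (Dom B v)) v))\<rparr>"

definition canonical_L1 :: "(unit, unit, 'o, 'm, unit, unit) pnt" where
  "canonical_L1 = \<lparr>Fn = (\<lambda>_. terminal_ftor), Cell = (\<lambda>_ _. ())\<rparr>"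

text \<open>The projections of \<open>\<omega>\<close> to \<open>F X\<close>, \<open>F Y\<close>, \<open>F Z\<close> are the canonical isomorphisms
  \<open>F \<pi>\<^sub>1 \<circ> F \<alpha> \<cong> F \<pi>\<^sub>1 \<circ> F \<pi>\<^sub>1\<close>, \<open>F \<pi>\<^sub>1 \<circ> F \<pi>\<^sub>2 \<circ> F \<alpha> \<cong> F \<pi>\<^sub>2 \<circ> F \<pi>\<^sub>1\<close> and
  \<open>F \<pi>\<^sub>2 \<circ> F \<pi>\<^sub>2 \<circ> F \<alpha> \<cong> F \<pi>\<^sub>2\<close>.\<close>

definition canonical_omega ::
  "('b, 'a, 'z) cart_cat_scheme \<Rightarrow> ('b, 'a, 'o, 'm) psf \<Rightarrow> ('b \<times> 'b) \<times> 'b \<Rightarrow> 'o \<Rightarrow> 'm \<times> 'm \<times> 'm" where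
  "canonical_omega B F = (\<lambda>((X, Y), Z).
    (let a = assoc B X Y Z; XY = Prod B X Y; YZ = Prod B Y Z
     in pair_cell
          (psf_square B F a (P1 B X YZ) (P1 B XY Z) (P1 B X Y))
          (pair_cell
            (inverse_cell (PO F Y) (PC F (P1 B XY Z) (P2 B X Y))
             \<bullet>\<^bsub>PO F Y\<^esub> psf_comp3 B F a (P2 B X YZ) (P1 B Y Z))
            (psf_comp3 B F a (P2 B X YZ) (P2 B Y Z)))))"

text \<open>Here \<open>\<pi>\<^sub>1 \<circ> (1 \<times> L\<^sup>1) \<circ> L = F \<pi>\<^sub>1\<close> and \<open>\<pi>\<^sub>2 \<circ> (L\<^sup>1 \<times> 1) \<circ> L = F \<pi>\<^sub>2\<close> on the nose.\<close>

definition canonical_zeta ::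
  "('b, 'a, 'z) cart_cat_scheme \<Rightarrow> ('b, 'a, 'o, 'm) psf \<Rightarrow> 'b \<Rightarrow> 'o \<Rightarrow> 'm" where
  "canonical_zeta B F X = id_cell (PO F X) (PA F (P1 B X (One B)))"

definition canonical_xi ::
  "('b, 'a, 'z) cart_cat_scheme \<Rightarrow> ('b, 'a, 'o, 'm) psf \<Rightarrow> 'b \<Rightarrow> 'o \<Rightarrow> 'm" where
  "canonical_xi B F X = id_cell (PO F X) (PA F (P2 B (One B) X))"

text \<open>The projections of \<open>\<theta>\<close> are \<open>F \<pi>\<^sub>1 \<circ> F \<sigma> \<cong> F \<pi>\<^sub>2\<close> and \<open>F \<pi>\<^sub>2 \<circ> F \<sigma> \<cong> F \<pi>\<^sub>1\<close>.\<close>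

definition canonical_theta ::
  "('b, 'a, 'z) cart_cat_scheme \<Rightarrow> ('b, 'a, 'o, 'm) psf \<Rightarrow> 'b \<times> 'b \<Rightarrow> 'o \<Rightarrow> 'm \<times> 'm" where
  "canonical_theta B F = (\<lambda>(X, Y).
     pair_cell (PC F (symm B X Y) (P1 B Y X)) (PC F (symm B X Y) (P2 B Y X)))"

end

(*
  For a fixed object x of F X, a path f1, ..., fn of arrows out of X determines the object
  F fn (... (F f1 x)) and, by pseudofunctoriality, an isomorphism from it to F (fn ... f1) x.
  Call an arrow between two such objects canonical if the paths have the same composite and the
  arrow commutes with these isomorphisms to the common target. There is at most one canonical arrow
  between the objects of two given paths. All constraint isomorphisms of F are canonical, and
  canonical arrows are closed under composition, inverses and application of F f. The projections
  to the factors of every 2-cell in the oplax structure are canonical, so they are natural and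
  invertible, and every coherence axiom holds as soon as the paths at both ends agree. That in turn
  is an identity between structural arrows of the cartesian category.
*)

theory Submission
  imports Defs
begin

section \<open>Isomorphisms, functors and products of categories\<close>

lemma hom_iff: "f \<in> hom C x y \<longleftrightarrow> f \<in> Arr C \<and> Dom C f = x \<and> Cod C f = y"
  by (simp add: hom_def)

lemma comp_in_hom: "category C \<Longrightarrow> f \<in> hom C x y \<Longrightarrow> g \<in> hom C y z \<Longrightarrow> g \<cdot>\<^bsub>C\<^esub> f \<in> hom C x z"
  by (auto simp: category_def hom_def)

lemma comp_assoc:
  "category C \<Longrightarrow> f \<in> hom C w x \<Longrightarrow> g \<in> hom C x y \<Longrightarrow> h \<in> hom C y z \<Longrightarrow>
    (h \<cdot>\<^bsub>C\<^esub> g) \<cdot>\<^bsub>C\<^esub> f = h \<cdot>\<^bsub>C\<^esub> (g \<cdot>\<^bsub>C\<^esub> f)"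
  by (auto simp: category_def hom_def)

lemma Ident_in_hom: "category C \<Longrightarrow> x \<in> Obj C \<Longrightarrow> Ident C x \<in> hom C x x"
  by (auto simp: category_def)

lemma comp_Ident: "category C \<Longrightarrow> f \<in> hom C x y \<Longrightarrow> f \<cdot>\<^bsub>C\<^esub> Ident C x = f"
  by (auto simp: category_def hom_def)

lemma Ident_comp: "category C \<Longrightarrow> f \<in> hom C x y \<Longrightarrow> Ident C y \<cdot>\<^bsub>C\<^esub> f = f"
  by (auto simp: category_def hom_def)

lemma hom_Obj: "category C \<Longrightarrow> f \<in> hom C x y \<Longrightarrow> x \<in> Obj C \<and> y \<in> Obj C"
  by (auto simp: category_def hom_def)

section \<open>Calculus of inverses and isomorphisms\<close>

lemma is_inverse_unique:
  assumes C: "category C" and f: "f \<in> Arr C" and "is_inverse C f g" "is_inverse C f h"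
  shows "g = h"
proof -
  have f': "f \<in> hom C (Dom C f) (Cod C f)"
    using f by (simp add: hom_iff)
  have g: "g \<in> hom C (Cod C f) (Dom C f)" "g \<cdot>\<^bsub>C\<^esub> f = Ident C (Dom C f)"
    and h: "h \<in> hom C (Cod C f) (Dom C f)" "f \<cdot>\<^bsub>C\<^esub> h = Ident C (Cod C f)"
    using assms by (auto simp: is_inverse_def)
  have "g = g \<cdot>\<^bsub>C\<^esub> (f \<cdot>\<^bsub>C\<^esub> h)"
    using comp_Ident[OF C g(1)] h by simp
  also have "\<dots> = h"
    using comp_assoc[OF C h(1) f' g(1)] Ident_comp[OF C h(1)] g by simp
  finally show ?thesis .
qed

lemma inverse_arr_eq: "category C \<Longrightarrow> f \<in> Arr C \<Longrightarrow> is_inverse C f g \<Longrightarrow> inverse_arr C f = g"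
  unfolding inverse_arr_def by (rule the_equality) (auto intro: is_inverse_unique)

lemma is_inverse_inverse_arr: "category C \<Longrightarrow> is_iso C f \<Longrightarrow> is_inverse C f (inverse_arr C f)"
  by (metis inverse_arr_eq is_iso_def)

lemma inverse_arr:
  assumes "category C" "is_iso C f" "f \<in> hom C x y"
  shows "inverse_arr C f \<in> hom C y x" "inverse_arr C f \<cdot>\<^bsub>C\<^esub> f = Ident C x"
    "f \<cdot>\<^bsub>C\<^esub> inverse_arr C f = Ident C y"
  using is_inverse_inverse_arr[OF assms(1,2)] assms(3) by (auto simp: is_inverse_def hom_iff)

lemma is_isoI:
  "f \<in> hom C x y \<Longrightarrow> g \<in> hom C y x \<Longrightarrow> g \<cdot>\<^bsub>C\<^esub> f = Ident C x \<Longrightarrow> f \<cdot>\<^bsub>C\<^esub> g = Ident C y \<Longrightarrow> is_iso C f"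
  by (auto simp: is_iso_def is_inverse_def hom_iff)

lemma is_iso_cancel:
  assumes C: "category C" and f: "is_iso C f" "f \<in> hom C y z" and g: "g \<in> hom C x y" and h: "h \<in> hom C x y"
    and eq: "f \<cdot>\<^bsub>C\<^esub> g = f \<cdot>\<^bsub>C\<^esub> h"
  shows "g = h"
  using comp_assoc[OF C g f(2) inverse_arr(1)[OF C f]] comp_assoc[OF C h f(2) inverse_arr(1)[OF C f]]
    inverse_arr(2)[OF C f] Ident_comp[OF C g] Ident_comp[OF C h] eq by metis

lemma is_iso_comp:
  assumes C: "category C" and f: "is_iso C f" "f \<in> hom C x y" and g: "is_iso C g" "g \<in> hom C y z"
  shows "is_iso C (g \<cdot>\<^bsub>C\<^esub> f)"
proof -
  let ?f = "inverse_arr C f" and ?g = "inverse_arr C g"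
  note f' = inverse_arr[OF C f] and g' = inverse_arr[OF C g]
  have "(?f \<cdot>\<^bsub>C\<^esub> ?g) \<cdot>\<^bsub>C\<^esub> (g \<cdot>\<^bsub>C\<^esub> f) = ?f \<cdot>\<^bsub>C\<^esub> ((?g \<cdot>\<^bsub>C\<^esub> g) \<cdot>\<^bsub>C\<^esub> f)"
    using comp_assoc[OF C comp_in_hom[OF C f(2) g(2)] g'(1) f'(1)] comp_assoc[OF C f(2) g(2) g'(1)]
    by simp
  moreover have "(g \<cdot>\<^bsub>C\<^esub> f) \<cdot>\<^bsub>C\<^esub> (?f \<cdot>\<^bsub>C\<^esub> ?g) = g \<cdot>\<^bsub>C\<^esub> ((f \<cdot>\<^bsub>C\<^esub> ?f) \<cdot>\<^bsub>C\<^esub> ?g)"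
    using comp_assoc[OF C comp_in_hom[OF C g'(1) f'(1)] f(2) g(2)] comp_assoc[OF C g'(1) f'(1) f(2)]
    by simp
  ultimately show ?thesis
    using is_isoI[OF comp_in_hom[OF C f(2) g(2)] comp_in_hom[OF C g'(1) f'(1)]]
      Ident_comp[OF C f(2)] Ident_comp[OF C g'(1)] f' g' by simp
qed

section \<open>Functors and natural isomorphisms, elementwise\<close>

lemma functor_Obj: "is_functor C D T \<Longrightarrow> x \<in> Obj C \<Longrightarrow> FO T x \<in> Obj D"
  by (simp add: is_functor_def)

lemma functor_hom: "is_functor C D T \<Longrightarrow> f \<in> hom C x y \<Longrightarrow> FA T f \<in> hom D (FO T x) (FO T y)"
  by (auto simp: is_functor_def hom_iff)

lemma functor_Ident: "is_functor C D T \<Longrightarrow> x \<in> Obj C \<Longrightarrow> FA T (Ident C x) = Ident D (FO T x)"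
  by (simp add: is_functor_def)

lemma functor_comp:
  "is_functor C D T \<Longrightarrow> f \<in> hom C x y \<Longrightarrow> g \<in> hom C y z \<Longrightarrow> FA T (g \<cdot>\<^bsub>C\<^esub> f) = FA T g \<cdot>\<^bsub>D\<^esub> FA T f"
  by (auto simp: is_functor_def hom_iff)

lemma functor_iso:
  assumes C: "category C" and T: "is_functor C D T" and f: "is_iso C f" "f \<in> hom C x y"
  shows "is_iso D (FA T f)"
  using is_isoI[OF functor_hom[OF T f(2)] functor_hom[OF T inverse_arr(1)[OF C f]]]
    functor_comp[OF T f(2) inverse_arr(1)[OF C f]] functor_comp[OF T inverse_arr(1)[OF C f] f(2)]
    inverse_arr(2,3)[OF C f] functor_Ident[OF T] hom_Obj[OF C f(2)] by simp

lemma nat_iso_hom: "nat_iso C D S T \<eta> \<Longrightarrow> x \<in> Obj C \<Longrightarrow> \<eta> x \<in> hom D (FO S x) (FO T x)"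
  by (simp add: nat_iso_def nat_trans_def)

lemma nat_iso_iso: "nat_iso C D S T \<eta> \<Longrightarrow> x \<in> Obj C \<Longrightarrow> is_iso D (\<eta> x)"
  by (simp add: nat_iso_def)

lemma nat_iso_natural:
  "nat_iso C D S T \<eta> \<Longrightarrow> f \<in> hom C x y \<Longrightarrow> \<eta> y \<cdot>\<^bsub>D\<^esub> FA S f = FA T f \<cdot>\<^bsub>D\<^esub> \<eta> x"
  by (auto simp: nat_iso_def nat_trans_def hom_iff)

section \<open>Product categories, computed factor by factor\<close>

lemma prod_cat_simps [simp]:
  "Obj (C \<times>\<^sub>C D) = Obj C \<times> Obj D" "Arr (C \<times>\<^sub>C D) = Arr C \<times> Arr D"
  "Dom (C \<times>\<^sub>C D) fg = (Dom C (fst fg), Dom D (snd fg))"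
  "Cod (C \<times>\<^sub>C D) fg = (Cod C (fst fg), Cod D (snd fg))"
  "Ident (C \<times>\<^sub>C D) xy = (Ident C (fst xy), Ident D (snd xy))"
  "gk \<cdot>\<^bsub>C \<times>\<^sub>C D\<^esub> fh = (fst gk \<cdot>\<^bsub>C\<^esub> fst fh, snd gk \<cdot>\<^bsub>D\<^esub> snd fh)"
  by (auto simp: prod_cat_def map_prod_def case_prod_unfold)

lemma hom_prod_cat: "fg \<in> hom (C \<times>\<^sub>C D) xy zw \<longleftrightarrow>
    fst fg \<in> hom C (fst xy) (fst zw) \<and> snd fg \<in> hom D (snd xy) (snd zw)"
  by (cases fg; cases xy; cases zw) (auto simp: hom_iff)

lemma is_inverse_prod_cat: "is_inverse (C \<times>\<^sub>C D) fg hk \<longleftrightarrow>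
    is_inverse C (fst fg) (fst hk) \<and> is_inverse D (snd fg) (snd hk)"
  by (auto simp: is_inverse_def hom_prod_cat)

lemma is_iso_prod_cat: "is_iso (C \<times>\<^sub>C D) fg \<longleftrightarrow> is_iso C (fst fg) \<and> is_iso D (snd fg)"
  by (cases fg) (auto simp: is_iso_def is_inverse_prod_cat)

lemma category_prod_cat: "category C \<Longrightarrow> category D \<Longrightarrow> category (C \<times>\<^sub>C D)"
  by (auto simp: category_def hom_prod_cat hom_iff)

text \<open>\<open>inverse_arr\<close> is a definite description, so the splitting relies on
  invertibility in both factors: this makes each description denote an actual inverse, and the pair
  of them satisfies \<open>is_inverse\<close> in the product.\<close>

lemma inverse_arr_prod_cat:
  assumes "category C" "category D" "is_iso C f" "is_iso D g"
  shows "inverse_arr (C \<times>\<^sub>C D) (f, g) = (inverse_arr C f, inverse_arr D g)"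
  by (rule inverse_arr_eq)
    (use assms in \<open>auto simp: category_prod_cat is_inverse_prod_cat is_inverse_inverse_arr is_iso_def\<close>)

lemma is_functor_pair_ftor: "is_functor E C S \<Longrightarrow> is_functor E D T \<Longrightarrow> is_functor E (C \<times>\<^sub>C D) (pair_ftor S T)"
  by (auto simp: is_functor_def pair_ftor_def hom_prod_cat)

text \<open>Reduces a 2-cell into a product to its projections. Canonical arrows live in single
  categories \<open>PO F Y\<close>, so every 2-cell of the oplax structure has to be split in this
  way before coherence applies.\<close>

lemma nat_iso_prod_cat: "nat_iso E (C \<times>\<^sub>C D) S T \<eta> \<longleftrightarrow>
    nat_iso E C (fst_ftor \<odot> S) (fst_ftor \<odot> T) (\<lambda>x. fst (\<eta> x)) \<and>
    nat_iso E D (snd_ftor \<odot> S) (snd_ftor \<odot> T) (\<lambda>x. snd (\<eta> x))"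
  by (auto simp: nat_iso_def nat_trans_def hom_prod_cat is_iso_prod_cat fst_ftor_def snd_ftor_def comp_ftor_def)

section \<open>Coherence for pseudofunctors into Cat\<close>

primrec path_cod :: "('b, 'a, 'z) cat_scheme \<Rightarrow> 'b \<Rightarrow> 'a list \<Rightarrow> 'b" where
  "path_cod B X [] = X"
| "path_cod B X (f # p) = Cod B f"

text \<open>Paths are written in composition order: the head of the list is applied last.\<close>

primrec is_path :: "('b, 'a, 'z) cat_scheme \<Rightarrow> 'b \<Rightarrow> 'a list \<Rightarrow> bool" where
  "is_path B X [] \<longleftrightarrow> X \<in> Obj B"
| "is_path B X (f # p) \<longleftrightarrow> f \<in> Arr B \<and> Dom B f = path_cod B X p \<and> is_path B X p"

primrec path_comp :: "('b, 'a, 'z) cat_scheme \<Rightarrow> 'b \<Rightarrow> 'a list \<Rightarrow> 'a" where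
  "path_comp B X [] = Ident B X"
| "path_comp B X (f # p) = f \<cdot>\<^bsub>B\<^esub> path_comp B X p"

primrec path_ftor :: "('b, 'a, 'o, 'm) psf \<Rightarrow> 'a list \<Rightarrow> ('o, 'm, 'o, 'm) ftor" where
  "path_ftor F [] = id_ftor"
| "path_ftor F (f # p) = PA F f \<odot> path_ftor F p"

text \<open>The recursion starts with \<open>PU\<close>, which puts the empty path on the same
  footing as the others. The target is uniformly \<open>F\<close> of \<open>path_comp\<close>; for a
  single arrow \<open>f\<close> this is \<open>F (f . 1)\<close>, where the two arrows of the base
  are literally composed.\<close>

primrec path_iso ::
  "('b, 'a, 'z) cat_scheme \<Rightarrow> ('b, 'a, 'o, 'm) psf \<Rightarrow> 'b \<Rightarrow> 'a list \<Rightarrow> 'o \<Rightarrow> 'm" where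
  "path_iso B F X [] = PU F X"
| "path_iso B F X (f # p) =
    PC F (path_comp B X p) f \<bullet>\<^bsub>PO F (Cod B f)\<^esub> PA F f \<lhd> path_iso B F X p"

text \<open>The paths are arguments of the relation because an object of \<open>PO F Y\<close> does
  not determine a path from \<open>x\<close> that leads to it. Equality of the composites gives the
  two comparison isomorphisms a common target.\<close>

definition canon ::
  "('b, 'a, 'z) cat_scheme \<Rightarrow> ('b, 'a, 'o, 'm) psf \<Rightarrow> 'b \<Rightarrow> 'o \<Rightarrow> 'a list \<Rightarrow> 'm \<Rightarrow> 'a list \<Rightarrow> bool" where
  "canon B F X x p m q \<longleftrightarrow> x \<in> Obj (PO F X) \<and> is_path B X p \<and> is_path B X q \<and>
     path_cod B X p = path_cod B X q \<and> path_comp B X p = path_comp B X q \<and>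
     m \<in> hom (PO F (path_cod B X p)) (FO (path_ftor F p) x) (FO (path_ftor F q) x) \<and>
     path_iso B F X q x \<cdot>\<^bsub>PO F (path_cod B X p)\<^esub> m = path_iso B F X p x"

lemma FO_comp_ftor [simp]: "FO (S \<odot> T) x = FO S (FO T x)"
  by (simp add: comp_ftor_def)

lemma FA_comp_ftor [simp]: "FA (S \<odot> T) f = FA S (FA T f)"
  by (simp add: comp_ftor_def)

lemma id_ftor_simps [simp]: "FO id_ftor x = x" "FA id_ftor f = f"
  by (simp_all add: id_ftor_def)

locale psf_cat =
  fixes B :: "('b, 'a, 'z) cat_scheme" and F :: "('b, 'a, 'o, 'm) psf"
  assumes category_base: "category B"
    and pseudofunctor: "pseudofunctor B F"
begin

section \<open>The pseudofunctor laws over an arbitrary base category\<close>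

lemma category_PO: "X \<in> Obj B \<Longrightarrow> category (PO F X)"
  using pseudofunctor by (simp add: pseudofunctor_def)

lemma functor_PA: "f \<in> hom B X Y \<Longrightarrow> is_functor (PO F X) (PO F Y) (PA F f)"
  using pseudofunctor by (auto simp: pseudofunctor_def hom_iff)

lemma nat_iso_PC:
  "f \<in> hom B X Y \<Longrightarrow> g \<in> hom B Y Z \<Longrightarrow>
    nat_iso (PO F X) (PO F Z) (PA F g \<odot> PA F f) (PA F (g \<cdot>\<^bsub>B\<^esub> f)) (PC F f g)"
  using pseudofunctor by (auto simp: pseudofunctor_def hom_iff)

lemma nat_iso_PU: "X \<in> Obj B \<Longrightarrow> nat_iso (PO F X) (PO F X) id_ftor (PA F (Ident B X)) (PU F X)"
  using pseudofunctor by (auto simp: pseudofunctor_def)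

lemma PC_assoc:
  assumes "f \<in> hom B X Y" "g \<in> hom B Y Z" "h \<in> hom B Z W" "x \<in> Obj (PO F X)"
  shows "PC F (g \<cdot>\<^bsub>B\<^esub> f) h x \<cdot>\<^bsub>PO F W\<^esub> FA (PA F h) (PC F f g x) =
    PC F f (h \<cdot>\<^bsub>B\<^esub> g) x \<cdot>\<^bsub>PO F W\<^esub> PC F g h (FO (PA F f) x)"
  using pseudofunctor assms
  by (auto simp: pseudofunctor_def hom_iff Let_def cells_eq_def vcomp_def whisker_left_def whisker_right_def)

lemma PC_Ident:
  assumes "f \<in> hom B X Y" "x \<in> Obj (PO F X)"
  shows "PC F f (Ident B Y) x \<cdot>\<^bsub>PO F Y\<^esub> PU F Y (FO (PA F f) x) = Ident (PO F Y) (FO (PA F f) x)"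
  using pseudofunctor assms
  by (auto simp: pseudofunctor_def hom_iff Let_def cells_eq_def vcomp_def whisker_left_def
      whisker_right_def id_cell_def)

section \<open>Functoriality and naturality along paths\<close>

lemma path_cod_Obj: "is_path B X p \<Longrightarrow> path_cod B X p \<in> Obj B"
  using category_base by (cases p) (auto simp: category_def)

lemma is_path_Cons_hom: "is_path B X (f # p) \<Longrightarrow> f \<in> hom B (path_cod B X p) (Cod B f)"
  by (simp add: hom_iff)

lemma path_comp_hom: "is_path B X p \<Longrightarrow> path_comp B X p \<in> hom B X (path_cod B X p)"
proof (induction p)
  case Nil
  then show ?case by (simp add: Ident_in_hom category_base)
next
  case (Cons f p)
  then show ?case
    using comp_in_hom[OF category_base _ is_path_Cons_hom[OF Cons.prems]] by simp
qed

lemma functor_path: "is_path B X p \<Longrightarrow> is_functor (PO F X) (PO F (path_cod B X p)) (path_ftor F p)"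
proof (induction p)
  case Nil
  then show ?case by (auto simp: is_functor_def hom_iff)
next
  case (Cons f p)
  have T: "is_functor (PO F (path_cod B X p)) (PO F (Cod B f)) (PA F f)"
    using functor_PA[OF is_path_Cons_hom[OF Cons.prems]] .
  have S: "is_functor (PO F X) (PO F (path_cod B X p)) (path_ftor F p)"
    using Cons by simp
  show ?case
    using functor_Obj[OF S] functor_Obj[OF T] functor_hom[OF T functor_hom[OF S]]
      functor_Ident[OF S] functor_Ident[OF T] functor_comp[OF S] functor_comp[OF T]
      functor_hom[OF S]
    by (auto simp: is_functor_def[of "PO F X" "PO F (Cod B f)"] hom_iff)
qed

text \<open>Induction on the path. The comparison for \<open>f # p\<close> is the image under
  \<open>F f\<close> of the one for \<open>p\<close>, followed by a component of \<open>PC\<close>.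
  Hence it is invertible, and its naturality square is the image of the square for \<open>p\<close>
  pasted to the square of \<open>PC\<close>.\<close>

lemma nat_iso_path_iso:
  "is_path B X p \<Longrightarrow> nat_iso (PO F X) (PO F (path_cod B X p)) (path_ftor F p)
    (PA F (path_comp B X p)) (path_iso B F X p)"
proof (induction p)
  case Nil
  then show ?case by (simp add: nat_iso_PU)
next
  case (Cons f p)
  let ?Y = "path_cod B X p" and ?Z = "Cod B f" and ?k = "path_comp B X p"
  have p: "is_path B X p" using Cons by simp
  note f = is_path_Cons_hom[OF Cons.prems]
  note T = functor_PA[OF f]
  note k = path_comp_hom[OF p]
  note IH = Cons.IH[OF p]
  note PC = nat_iso_PC[OF k f]
  note Y = category_PO[OF path_cod_Obj[OF p]]
  have Z: "category (PO F ?Z)"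
    using category_PO[OF path_cod_Obj[OF Cons.prems]] by simp
  have 1: "path_iso B F X (f # p) x \<in> hom (PO F ?Z) (FO (path_ftor F (f # p)) x)
      (FO (PA F (path_comp B X (f # p))) x) \<and> is_iso (PO F ?Z) (path_iso B F X (f # p) x)"
    if "x \<in> Obj (PO F X)" for x
    using comp_in_hom[OF Z functor_hom[OF T nat_iso_hom[OF IH that]]] nat_iso_hom[OF PC that]
      is_iso_comp[OF Z functor_iso[OF Y T nat_iso_iso[OF IH that] nat_iso_hom[OF IH that]]
        functor_hom[OF T nat_iso_hom[OF IH that]] nat_iso_iso[OF PC that]]
    by (simp add: vcomp_def whisker_left_def)
  have 2: "path_iso B F X (f # p) y \<cdot>\<^bsub>PO F ?Z\<^esub> FA (path_ftor F (f # p)) g =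
      FA (PA F (path_comp B X (f # p))) g \<cdot>\<^bsub>PO F ?Z\<^esub> path_iso B F X (f # p) x"
    if g: "g \<in> hom (PO F X) x y" for g x y
  proof -
    have xy: "x \<in> Obj (PO F X)" "y \<in> Obj (PO F X)"
      using hom_Obj[OF category_PO g] hom_Obj[OF category_base k] by auto
    let ?cx = "path_iso B F X p x" and ?cy = "path_iso B F X p y"
    note cx = nat_iso_hom[OF IH xy(1)] and cy = nat_iso_hom[OF IH xy(2)]
    note pg = functor_hom[OF functor_path[OF p] g]
    note kg = functor_hom[OF functor_PA[OF k] g]
    have PCx: "PC F ?k f x \<in> hom (PO F ?Z) (FO (PA F f) (FO (PA F ?k) x)) (FO (PA F (f \<cdot>\<^bsub>B\<^esub> ?k)) x)"
      and PCy: "PC F ?k f y \<in> hom (PO F ?Z) (FO (PA F f) (FO (PA F ?k) y)) (FO (PA F (f \<cdot>\<^bsub>B\<^esub> ?k)) y)"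
      using nat_iso_hom[OF PC xy(1)] nat_iso_hom[OF PC xy(2)] by simp_all
    note fkg = functor_hom[OF functor_PA[OF comp_in_hom[OF category_base k f]] g]
    have "path_iso B F X (f # p) y \<cdot>\<^bsub>PO F ?Z\<^esub> FA (path_ftor F (f # p)) g =
        PC F ?k f y \<cdot>\<^bsub>PO F ?Z\<^esub> FA (PA F f) (?cy \<cdot>\<^bsub>PO F ?Y\<^esub> FA (path_ftor F p) g)"
      using comp_assoc[OF Z functor_hom[OF T pg] functor_hom[OF T cy] PCy] functor_comp[OF T pg cy]
      by (simp add: vcomp_def whisker_left_def)
    also have "\<dots> = (PC F ?k f y \<cdot>\<^bsub>PO F ?Z\<^esub> FA (PA F f) (FA (PA F ?k) g)) \<cdot>\<^bsub>PO F ?Z\<^esub> FA (PA F f) ?cx"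
      using nat_iso_natural[OF IH g] functor_comp[OF T cx kg]
        comp_assoc[OF Z functor_hom[OF T cx] functor_hom[OF T kg] PCy] by simp
    also have "\<dots> = FA (PA F (f \<cdot>\<^bsub>B\<^esub> ?k)) g \<cdot>\<^bsub>PO F ?Z\<^esub> path_iso B F X (f # p) x"
      using nat_iso_natural[OF PC g] comp_assoc[OF Z functor_hom[OF T cx] PCx fkg]
      by (simp add: vcomp_def whisker_left_def)
    finally show ?thesis by simp
  qed
  show ?case
    using 1 2 by (auto simp: nat_iso_def nat_trans_def hom_iff)
qed

section \<open>Uniqueness and closure properties of canonical arrows\<close>

lemma canon_unique_same:
  assumes m: "canon B F X x p m q" and n: "canon B F X x p n q"
  shows "m = n"
proof -
  have p: "is_path B X p" and q: "is_path B X q" and x: "x \<in> Obj (PO F X)"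
    and cod: "path_cod B X q = path_cod B X p"
    using m by (auto simp: canon_def)
  show ?thesis
    \<comment> \<open>The comparison along \<open>q\<close> is invertible, so it cancels from the
      defining equations of \<open>m\<close> and \<open>n\<close>.\<close>
    by (rule is_iso_cancel[OF category_PO[OF path_cod_Obj[OF p]]
          nat_iso_iso[OF nat_iso_path_iso[OF q] x, unfolded cod]
          nat_iso_hom[OF nat_iso_path_iso[OF q] x, unfolded cod]])
      (use m n in \<open>auto simp: canon_def\<close>)
qed

text \<open>The first premise is redundant, but resolving with it fixes the base point.\<close>

lemma canon_unique:
  "x \<in> Obj (PO F X) \<Longrightarrow> canon B F X x p m q \<Longrightarrow> canon B F X x p' n q' \<Longrightarrow> p = p' \<Longrightarrow> q = q' \<Longrightarrow> m = n"
  using canon_unique_same by blast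

text \<open>The object \<open>y\<close> is a variable of its own, tied to the path by the first
  premise. When the path is still unknown, solving this premise reconstructs it from the shape of
  \<open>y\<close>. The rules for \<open>PC\<close> and \<open>PU\<close> below have the same
  form.\<close>

lemma canon_Ident:
  assumes "FO (path_ftor F p) x = y" "x \<in> Obj (PO F X)" "is_path B X p" "Y = path_cod B X p"
  shows "canon B F X x p (Ident (PO F Y) y) p"
  using assms comp_Ident[OF category_PO[OF path_cod_Obj] nat_iso_hom[OF nat_iso_path_iso]]
    Ident_in_hom[OF category_PO[OF path_cod_Obj] functor_Obj[OF functor_path]]
  by (auto simp: canon_def)

text \<open>The middle paths are kept apart as \<open>q\<close> and \<open>q'\<close> because they
  are read off different arrows. Their equality is an identity between arrows of the base and is
  left to rewriting there.\<close>

lemma canon_comp: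
  assumes m: "canon B F X x p m q" and n: "canon B F X x q' n r" and "q = q'" "Y = path_cod B X p"
  shows "canon B F X x p (n \<cdot>\<^bsub>PO F Y\<^esub> m) r"
proof -
  have p: "is_path B X p" and r: "is_path B X r" and x: "x \<in> Obj (PO F X)"
    and cod: "path_cod B X p = Y" "path_cod B X q = Y" "path_cod B X r = Y"
    using assms by (auto simp: canon_def)
  have c: "path_iso B F X r x \<in> hom (PO F Y) (FO (path_ftor F r) x) (FO (PA F (path_comp B X r)) x)"
    using nat_iso_hom[OF nat_iso_path_iso[OF r] x] cod by simp
  have m': "m \<in> hom (PO F Y) (FO (path_ftor F p) x) (FO (path_ftor F q) x)"
    and n': "n \<in> hom (PO F Y) (FO (path_ftor F q) x) (FO (path_ftor F r) x)"
    using m n assms(3) cod by (auto simp: canon_def)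
  have Y: "category (PO F Y)"
    using category_PO[OF path_cod_Obj[OF p]] cod by simp
  show ?thesis
    using m n assms(3) cod comp_assoc[OF Y m' n' c] comp_in_hom[OF Y m' n'] by (auto simp: canon_def)
qed

text \<open>\<open>F f\<close> is applied to the defining equation of \<open>m\<close>, and the
  result is composed with \<open>PC\<close>. The same component of \<open>PC\<close> serves both
  paths, since their composites agree.\<close>

lemma canon_FA:
  assumes m: "canon B F X x p m q" and f: "is_path B X (f # p)"
  shows "canon B F X x (f # p) (FA (PA F f) m) (f # q)"
proof -
  let ?Y = "path_cod B X p" and ?Z = "Cod B f"
  have p: "is_path B X p" and q: "is_path B X q" and x: "x \<in> Obj (PO F X)"
    and cod: "path_cod B X q = ?Y" and comp: "path_comp B X q = path_comp B X p"
    and m': "m \<in> hom (PO F ?Y) (FO (path_ftor F p) x) (FO (path_ftor F q) x)"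
    and eq: "path_iso B F X q x \<cdot>\<^bsub>PO F ?Y\<^esub> m = path_iso B F X p x"
    using m by (auto simp: canon_def)
  note f' = is_path_Cons_hom[OF f]
  note T = functor_PA[OF f']
  have c: "path_iso B F X q x \<in> hom (PO F ?Y) (FO (path_ftor F q) x) (FO (PA F (path_comp B X p)) x)"
    using nat_iso_hom[OF nat_iso_path_iso[OF q] x] cod comp by simp
  have PC: "PC F (path_comp B X p) f x \<in> hom (PO F ?Z)
      (FO (PA F f) (FO (PA F (path_comp B X p)) x)) (FO (PA F (f \<cdot>\<^bsub>B\<^esub> path_comp B X p)) x)"
    using nat_iso_hom[OF nat_iso_PC[OF path_comp_hom[OF p] f'] x] by simp
  have Z: "category (PO F ?Z)"
    using category_PO[OF path_cod_Obj[OF f]] by simp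
  show ?thesis
    using f x q cod comp functor_hom[OF T m'] functor_comp[OF T m' c] eq
      comp_assoc[OF Z functor_hom[OF T m'] functor_hom[OF T c] PC]
    by (simp add: canon_def vcomp_def whisker_left_def)
qed

text \<open>Naturality of \<open>PC F f g\<close> at the comparison for \<open>p\<close> moves the
  arrow to the object \<open>F k x\<close>, with \<open>k\<close> the composite of \<open>p\<close>.
  There the associativity law of the pseudofunctor for \<open>k\<close>, \<open>f\<close>,
  \<open>g\<close> gives the defining equation.\<close>

lemma canon_PC:
  assumes y: "FO (path_ftor F p) x = y" and x: "x \<in> Obj (PO F X)" and path: "is_path B X (g # f # p)"
  shows "canon B F X x (g # f # p) (PC F f g y) ((g \<cdot>\<^bsub>B\<^esub> f) # p)"
proof -
  let ?Y = "path_cod B X p" and ?Z = "Cod B f" and ?W = "Cod B g" and ?k = "path_comp B X p"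
  let ?c = "path_iso B F X p x"
  have p: "is_path B X p" and g: "g \<in> hom B ?Z ?W" and f: "f \<in> hom B ?Y ?Z"
    using path by (auto simp: hom_iff)
  note gf = comp_in_hom[OF category_base f g]
  note k = path_comp_hom[OF p]
  have W: "category (PO F ?W)" and Y: "category (PO F ?Y)"
    using category_PO hom_Obj[OF category_base g] hom_Obj[OF category_base f] by auto
  have c: "?c \<in> hom (PO F ?Y) y (FO (PA F ?k) x)"
    using nat_iso_hom[OF nat_iso_path_iso[OF p] x] y by simp
  have y': "y \<in> Obj (PO F ?Y)" and kx: "FO (PA F ?k) x \<in> Obj (PO F ?Y)"
    using hom_Obj[OF Y c] by auto
  note T = functor_PA[OF f] and S = functor_PA[OF g]
  have fgy: "PC F f g y \<in> hom (PO F ?W) (FO (PA F g) (FO (PA F f) y)) (FO (PA F (g \<cdot>\<^bsub>B\<^esub> f)) y)"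
    using nat_iso_hom[OF nat_iso_PC[OF f g] y'] by simp
  have fgk: "PC F f g (FO (PA F ?k) x) \<in> hom (PO F ?W) (FO (PA F g) (FO (PA F f) (FO (PA F ?k) x)))
      (FO (PA F (g \<cdot>\<^bsub>B\<^esub> f)) (FO (PA F ?k) x))"
    using nat_iso_hom[OF nat_iso_PC[OF f g] kx] by simp
  have kgf: "PC F ?k (g \<cdot>\<^bsub>B\<^esub> f) x \<in> hom (PO F ?W) (FO (PA F (g \<cdot>\<^bsub>B\<^esub> f)) (FO (PA F ?k) x))
      (FO (PA F ((g \<cdot>\<^bsub>B\<^esub> f) \<cdot>\<^bsub>B\<^esub> ?k)) x)"
    using nat_iso_hom[OF nat_iso_PC[OF k gf] x] by simp
  have kf: "PC F ?k f x \<in> hom (PO F ?Z) (FO (PA F f) (FO (PA F ?k) x)) (FO (PA F (f \<cdot>\<^bsub>B\<^esub> ?k)) x)"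
    using nat_iso_hom[OF nat_iso_PC[OF k f] x] by simp
  have fkg: "PC F (f \<cdot>\<^bsub>B\<^esub> ?k) g x \<in> hom (PO F ?W) (FO (PA F g) (FO (PA F (f \<cdot>\<^bsub>B\<^esub> ?k)) x))
      (FO (PA F (g \<cdot>\<^bsub>B\<^esub> f \<cdot>\<^bsub>B\<^esub> ?k)) x)"
    using nat_iso_hom[OF nat_iso_PC[OF comp_in_hom[OF category_base k f] g] x] by simp
  note Tc = functor_hom[OF T c]
  note STc = functor_hom[OF S Tc]
  have "path_iso B F X ((g \<cdot>\<^bsub>B\<^esub> f) # p) x \<cdot>\<^bsub>PO F ?W\<^esub> PC F f g y =
      PC F ?k (g \<cdot>\<^bsub>B\<^esub> f) x \<cdot>\<^bsub>PO F ?W\<^esub> (FA (PA F (g \<cdot>\<^bsub>B\<^esub> f)) ?c \<cdot>\<^bsub>PO F ?W\<^esub> PC F f g y)"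
    using comp_assoc[OF W fgy functor_hom[OF functor_PA[OF gf] c] kgf] gf
    by (simp add: vcomp_def whisker_left_def hom_iff)
  also have "\<dots> = (PC F ?k (g \<cdot>\<^bsub>B\<^esub> f) x \<cdot>\<^bsub>PO F ?W\<^esub> PC F f g (FO (PA F ?k) x)) \<cdot>\<^bsub>PO F ?W\<^esub>
      FA (PA F g) (FA (PA F f) ?c)"
    using nat_iso_natural[OF nat_iso_PC[OF f g] c] comp_assoc[OF W STc fgk kgf] by simp
  also have "\<dots> = (PC F (f \<cdot>\<^bsub>B\<^esub> ?k) g x \<cdot>\<^bsub>PO F ?W\<^esub> FA (PA F g) (PC F ?k f x)) \<cdot>\<^bsub>PO F ?W\<^esub>
      FA (PA F g) (FA (PA F f) ?c)"
    using PC_assoc[OF k f g x] by simp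
  also have "\<dots> = path_iso B F X (g # f # p) x"
    using comp_assoc[OF W STc functor_hom[OF S kf] fkg] functor_comp[OF S Tc kf]
    by (simp add: vcomp_def whisker_left_def)
  finally show ?thesis
    using x path gf fgy y comp_assoc[OF category_base k f g] by (simp add: canon_def hom_iff)
qed

text \<open>As for \<open>PC\<close>: naturality of \<open>PU\<close> at the comparison for
  \<open>p\<close> moves the arrow to \<open>F k x\<close>, where the unit law
  \<open>PC_Ident\<close> applies.\<close>

lemma canon_PU:
  assumes y: "FO (path_ftor F p) x = y" and x: "x \<in> Obj (PO F X)" and p: "is_path B X p"
    and Y: "Y = path_cod B X p"
  shows "canon B F X x p (PU F Y y) (Ident B Y # p)"
proof -
  let ?k = "path_comp B X p" and ?c = "path_iso B F X p x"
  have YO: "Y \<in> Obj B" and k: "?k \<in> hom B X Y"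
    using path_cod_Obj[OF p] path_comp_hom[OF p] Y by auto
  note YC = category_PO[OF YO]
  have c: "?c \<in> hom (PO F Y) y (FO (PA F ?k) x)"
    using nat_iso_hom[OF nat_iso_path_iso[OF p] x] y Y by simp
  have y': "y \<in> Obj (PO F Y)" and kx: "FO (PA F ?k) x \<in> Obj (PO F Y)"
    using hom_Obj[OF YC c] by auto
  note I = Ident_in_hom[OF category_base YO]
  have PU: "PU F Y y \<in> hom (PO F Y) y (FO (PA F (Ident B Y)) y)"
    using nat_iso_hom[OF nat_iso_PU[OF YO] y'] by simp
  have PUk: "PU F Y (FO (PA F ?k) x) \<in> hom (PO F Y) (FO (PA F ?k) x) (FO (PA F (Ident B Y)) (FO (PA F ?k) x))"
    using nat_iso_hom[OF nat_iso_PU[OF YO] kx] by simp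
  have PC: "PC F ?k (Ident B Y) x \<in> hom (PO F Y) (FO (PA F (Ident B Y)) (FO (PA F ?k) x))
      (FO (PA F (Ident B Y \<cdot>\<^bsub>B\<^esub> ?k)) x)"
    using nat_iso_hom[OF nat_iso_PC[OF k I] x] by simp
  have "path_iso B F X (Ident B Y # p) x \<cdot>\<^bsub>PO F Y\<^esub> PU F Y y =
      PC F ?k (Ident B Y) x \<cdot>\<^bsub>PO F Y\<^esub> (FA (PA F (Ident B Y)) ?c \<cdot>\<^bsub>PO F Y\<^esub> PU F Y y)"
    using comp_assoc[OF YC PU functor_hom[OF functor_PA[OF I] c] PC] I
    by (simp add: vcomp_def whisker_left_def hom_iff)
  also have "\<dots> = (PC F ?k (Ident B Y) x \<cdot>\<^bsub>PO F Y\<^esub> PU F Y (FO (PA F ?k) x)) \<cdot>\<^bsub>PO F Y\<^esub> ?c"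
    using nat_iso_natural[OF nat_iso_PU[OF YO] c] comp_assoc[OF YC c PUk PC] by simp
  also have "\<dots> = ?c"
    using PC_Ident[OF k x] Ident_comp[OF YC c] by simp
  finally show ?thesis
    using x p I PU y Y Ident_comp[OF category_base k] by (simp add: canon_def hom_iff)
qed

text \<open>The defining equation exhibits \<open>m\<close> as the comparison for \<open>p\<close>
  followed by the inverse of the comparison for \<open>q\<close>, a composite of
  isomorphisms.\<close>

lemma canon_iso:
  assumes m: "canon B F X x p m q" and Y: "Y = path_cod B X p"
  shows "is_iso (PO F Y) m"
proof -
  let ?d = "path_iso B F X q x" and ?c = "path_iso B F X p x"
  have p: "is_path B X p" and q: "is_path B X q" and x: "x \<in> Obj (PO F X)"
    and cod: "path_cod B X q = Y" and comp: "path_comp B X q = path_comp B X p"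
    and m': "m \<in> hom (PO F Y) (FO (path_ftor F p) x) (FO (path_ftor F q) x)"
    and eq: "?d \<cdot>\<^bsub>PO F Y\<^esub> m = ?c"
    using m Y by (auto simp: canon_def)
  have YC: "category (PO F Y)"
    using category_PO[OF path_cod_Obj[OF p]] Y by simp
  have c: "is_iso (PO F Y) ?c" "?c \<in> hom (PO F Y) (FO (path_ftor F p) x) (FO (PA F (path_comp B X p)) x)"
    and d: "is_iso (PO F Y) ?d" "?d \<in> hom (PO F Y) (FO (path_ftor F q) x) (FO (PA F (path_comp B X p)) x)"
    using nat_iso_hom[OF nat_iso_path_iso[OF p] x] nat_iso_hom[OF nat_iso_path_iso[OF q] x]
      nat_iso_iso[OF nat_iso_path_iso[OF p] x] nat_iso_iso[OF nat_iso_path_iso[OF q] x] Y cod comp by simp_all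
  note d' = inverse_arr[OF YC d]
  have "is_iso (PO F Y) (inverse_arr (PO F Y) ?d)"
    using is_isoI[OF d'(1) d(2)] d' by simp
  then have "is_iso (PO F Y) (inverse_arr (PO F Y) ?d \<cdot>\<^bsub>PO F Y\<^esub> ?c)"
    using is_iso_comp[OF YC c _ d'(1)] by simp
  moreover have "inverse_arr (PO F Y) ?d \<cdot>\<^bsub>PO F Y\<^esub> ?c = m"
    using comp_assoc[OF YC m' d(2) d'(1)] Ident_comp[OF YC m'] d' eq by simp
  ultimately show ?thesis by simp
qed

lemma canon_inverse:
  assumes m: "canon B F X x p m q" and Y: "Y = path_cod B X p"
  shows "canon B F X x q (inverse_arr (PO F Y) m) p"
proof -
  let ?d = "path_iso B F X q x" and ?c = "path_iso B F X p x"
  have p: "is_path B X p" and q: "is_path B X q" and x: "x \<in> Obj (PO F X)"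
    and cod: "path_cod B X q = Y" and comp: "path_comp B X q = path_comp B X p"
    and m': "m \<in> hom (PO F Y) (FO (path_ftor F p) x) (FO (path_ftor F q) x)"
    and eq: "?d \<cdot>\<^bsub>PO F Y\<^esub> m = ?c"
    using m Y by (auto simp: canon_def)
  have YC: "category (PO F Y)"
    using category_PO[OF path_cod_Obj[OF p]] Y by simp
  have d: "?d \<in> hom (PO F Y) (FO (path_ftor F q) x) (FO (PA F (path_comp B X p)) x)"
    using nat_iso_hom[OF nat_iso_path_iso[OF q] x] Y cod comp by simp
  note n = inverse_arr[OF YC canon_iso[OF assms] m']
  show ?thesis
    using m Y cod comp n comp_assoc[OF YC n(1) m' d] comp_Ident[OF YC d] eq by (simp add: canon_def)
qed

text \<open>Naturality comes for free when all components are canonical for the same pair of paths.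
  The premise on components stands first because its proof finds the paths. \<open>S\<close> and
  \<open>T\<close> enter through equations because they become the functors of these paths only
  after evaluation of projections, pairings and the like.\<close>

lemma canon_nat_iso:
  assumes canon: "\<And>x. x \<in> Obj (PO F X) \<Longrightarrow> canon B F X x p (m x) q"
    and p: "is_path B X p" and q: "is_path B X q"
    and Y: "Y = path_cod B X p" "path_cod B X q = path_cod B X p"
    and eq: "path_comp B X q = path_comp B X p"
    and ST: "path_ftor F p = S" "path_ftor F q = T" and XO: "X \<in> Obj B"
  shows "nat_iso (PO F X) (PO F Y) S T m"
proof -
  have YC: "category (PO F Y)"
    using category_PO[OF path_cod_Obj[OF p]] Y by simp
  let ?d = "path_iso B F X q" and ?c = "path_iso B F X p" and ?k = "path_comp B X p"
  have C: "nat_iso (PO F X) (PO F Y) S (PA F ?k) ?c" and D: "nat_iso (PO F X) (PO F Y) T (PA F ?k) ?d"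
    using nat_iso_path_iso[OF p] nat_iso_path_iso[OF q] Y eq ST by simp_all
  have hom: "m x \<in> hom (PO F Y) (FO S x) (FO T x)" and m: "?d x \<cdot>\<^bsub>PO F Y\<^esub> m x = ?c x"
    if "x \<in> Obj (PO F X)" for x
    using canon[OF that] Y ST by (auto simp: canon_def)
  have "m y \<cdot>\<^bsub>PO F Y\<^esub> FA S f = FA T f \<cdot>\<^bsub>PO F Y\<^esub> m x" if f: "f \<in> hom (PO F X) x y" for f x y
  proof -
    have x: "x \<in> Obj (PO F X)" and y: "y \<in> Obj (PO F X)"
      using hom_Obj[OF category_PO[OF XO] f] by auto
    have Sf: "FA S f \<in> hom (PO F Y) (FO S x) (FO S y)" and Tf: "FA T f \<in> hom (PO F Y) (FO T x) (FO T y)"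
      using functor_hom[OF functor_path[OF p] f] functor_hom[OF functor_path[OF q] f] ST Y by simp_all
    have kf: "FA (PA F ?k) f \<in> hom (PO F Y) (FO (PA F ?k) x) (FO (PA F ?k) y)"
      using functor_hom[OF functor_PA[OF path_comp_hom[OF p]] f] Y by simp
    note dx = nat_iso_hom[OF D x] and dy = nat_iso_hom[OF D y]
    \<comment> \<open>Both sides of the naturality square of \<open>m\<close> are composed with the
      invertible \<open>?d y\<close>. What remains follows from naturality of the two comparisons
      \<open>?c\<close> and \<open>?d\<close>.\<close>
    have "?d y \<cdot>\<^bsub>PO F Y\<^esub> (m y \<cdot>\<^bsub>PO F Y\<^esub> FA S f) = FA (PA F ?k) f \<cdot>\<^bsub>PO F Y\<^esub> (?d x \<cdot>\<^bsub>PO F Y\<^esub> m x)"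
      using comp_assoc[OF YC Sf hom[OF y] dy] m[OF y] m[OF x] nat_iso_natural[OF C f] by simp
    also have "\<dots> = ?d y \<cdot>\<^bsub>PO F Y\<^esub> (FA T f \<cdot>\<^bsub>PO F Y\<^esub> m x)"
      using comp_assoc[OF YC hom[OF x] dx kf] comp_assoc[OF YC hom[OF x] Tf dy] nat_iso_natural[OF D f]
      by simp
    finally show ?thesis
      using is_iso_cancel[OF YC nat_iso_iso[OF D y] dy] comp_in_hom[OF YC Sf hom[OF y]]
        comp_in_hom[OF YC hom[OF x] Tf] by blast
  qed
  then show ?thesis
    using hom canon_iso[OF canon Y(1)] by (auto simp: nat_iso_def nat_trans_def hom_iff)
qed

end

section \<open>Chosen finite products\<close>

locale cart =
  fixes B :: "('b, 'a, 'z) cart_cat_scheme"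
  assumes cartesian: "cartesian B"
begin

section \<open>Rewriting with chosen products\<close>

lemma category_B: "category B"
  using cartesian by (simp add: cartesian_def)

lemma Dom_Cod_Obj [simp]: "f \<in> Arr B \<Longrightarrow> Dom B f \<in> Obj B" "f \<in> Arr B \<Longrightarrow> Cod B f \<in> Obj B"
  using category_B by (auto simp: category_def)

lemma Ident_simps [simp]:
  "X \<in> Obj B \<Longrightarrow> Ident B X \<in> Arr B" "X \<in> Obj B \<Longrightarrow> Dom B (Ident B X) = X"
  "X \<in> Obj B \<Longrightarrow> Cod B (Ident B X) = X"
  using Ident_in_hom[OF category_B] by (auto simp: hom_iff)

lemma comp_simps [simp]:
  assumes "f \<in> Arr B" "g \<in> Arr B" "Cod B f = Dom B g"
  shows "g \<cdot>\<^bsub>B\<^esub> f \<in> Arr B" "Dom B (g \<cdot>\<^bsub>B\<^esub> f) = Dom B f" "Cod B (g \<cdot>\<^bsub>B\<^esub> f) = Cod B g"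
  using comp_in_hom[OF category_B, of f "Dom B f" "Dom B g" g] assms by (auto simp: hom_iff)

lemma comp_assoc_simp [simp]:
  "f \<in> Arr B \<Longrightarrow> g \<in> Arr B \<Longrightarrow> h \<in> Arr B \<Longrightarrow> Cod B f = Dom B g \<Longrightarrow> Cod B g = Dom B h \<Longrightarrow>
    (h \<cdot>\<^bsub>B\<^esub> g) \<cdot>\<^bsub>B\<^esub> f = h \<cdot>\<^bsub>B\<^esub> (g \<cdot>\<^bsub>B\<^esub> f)"
  using category_B by (auto simp: category_def)

lemma Ident_unit_simps [simp]:
  "f \<in> Arr B \<Longrightarrow> Dom B f = X \<Longrightarrow> f \<cdot>\<^bsub>B\<^esub> Ident B X = f"
  "f \<in> Arr B \<Longrightarrow> Cod B f = X \<Longrightarrow> Ident B X \<cdot>\<^bsub>B\<^esub> f = f"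
  using category_B by (auto simp: category_def)

lemma Prod_simps [simp]:
  assumes "X \<in> Obj B" "Y \<in> Obj B"
  shows "Prod B X Y \<in> Obj B" "P1 B X Y \<in> Arr B" "P2 B X Y \<in> Arr B"
    "Dom B (P1 B X Y) = Prod B X Y" "Dom B (P2 B X Y) = Prod B X Y"
    "Cod B (P1 B X Y) = X" "Cod B (P2 B X Y) = Y"
  using cartesian assms by (auto simp: cartesian_def hom_iff)

lemma One_Obj [simp]: "One B \<in> Obj B"
  using cartesian by (simp add: cartesian_def)

text \<open>The universal property with all objects read off from \<open>f\<close> and
  \<open>g\<close>, which is the form of the description that defines \<open>tuple\<close>.\<close>

lemma product_universal:
  assumes "f \<in> Arr B" "g \<in> Arr B" "Dom B f = Dom B g"
  shows "\<exists>!h. h \<in> hom B (Dom B f) (Prod B (Cod B f) (Cod B g)) \<and>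
    P1 B (Cod B f) (Cod B g) \<cdot>\<^bsub>B\<^esub> h = f \<and> P2 B (Cod B f) (Cod B g) \<cdot>\<^bsub>B\<^esub> h = g"
proof -
  have "f \<in> hom B (Dom B f) (Cod B f)" "g \<in> hom B (Dom B f) (Cod B g)"
    "Dom B f \<in> Obj B" "Cod B f \<in> Obj B" "Cod B g \<in> Obj B"
    using assms by (simp_all add: hom_iff)
  then show ?thesis
    using cartesian[unfolded cartesian_def, THEN conjunct2, THEN conjunct1,
        THEN bspec[of _ _ "Cod B f"], THEN bspec[of _ _ "Cod B g"]] assms(3)
    by (metis (no_types, lifting))
qed

text \<open>The uniqueness half of the universal property, applied to the projections of
  \<open>k\<close>. All identities between structural arrows below rest on it.\<close>

lemma product_ext:
  assumes "h \<in> Arr B" "k \<in> Arr B" "Cod B h = Prod B X Y" "Cod B k = Prod B X Y" "Dom B h = Dom B k"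
    "X \<in> Obj B" "Y \<in> Obj B"
    and "P1 B X Y \<cdot>\<^bsub>B\<^esub> h = P1 B X Y \<cdot>\<^bsub>B\<^esub> k" "P2 B X Y \<cdot>\<^bsub>B\<^esub> h = P2 B X Y \<cdot>\<^bsub>B\<^esub> k"
  shows "h = k"
  using product_universal[of "P1 B X Y \<cdot>\<^bsub>B\<^esub> k" "P2 B X Y \<cdot>\<^bsub>B\<^esub> k"] assms by (auto simp: hom_iff)

lemma tuple_props:
  assumes "f \<in> Arr B" "g \<in> Arr B" "Dom B f = Dom B g"
  shows "tuple B f g \<in> hom B (Dom B f) (Prod B (Cod B f) (Cod B g)) \<and>
    P1 B (Cod B f) (Cod B g) \<cdot>\<^bsub>B\<^esub> tuple B f g = f \<and> P2 B (Cod B f) (Cod B g) \<cdot>\<^bsub>B\<^esub> tuple B f g = g"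
  unfolding tuple_def by (rule theI'[OF product_universal[OF assms]])

lemma tuple_simps [simp]:
  assumes "f \<in> Arr B" "g \<in> Arr B" "Dom B f = Dom B g"
  shows "tuple B f g \<in> Arr B" "Dom B (tuple B f g) = Dom B f"
    "Cod B (tuple B f g) = Prod B (Cod B f) (Cod B g)"
    "Cod B f = X \<Longrightarrow> Cod B g = Y \<Longrightarrow> P1 B X Y \<cdot>\<^bsub>B\<^esub> tuple B f g = f"
    "Cod B f = X \<Longrightarrow> Cod B g = Y \<Longrightarrow> P2 B X Y \<cdot>\<^bsub>B\<^esub> tuple B f g = g"
  using tuple_props[OF assms] by (auto simp: hom_iff)

text \<open>Composites are normalised by bracketing to the right, which separates a projection from
  the redex it would form with \<open>tuple\<close>. The variants with a further arrow
  \<open>h\<close> restore the computation; the analogous rules for the other structural arrows do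
  the same.\<close>

lemma tuple_comp_simps [simp]:
  assumes "f \<in> Arr B" "g \<in> Arr B" "Dom B f = Dom B g" "Cod B f = X" "Cod B g = Y"
    "h \<in> Arr B" "Cod B h = Dom B f"
  shows "P1 B X Y \<cdot>\<^bsub>B\<^esub> (tuple B f g \<cdot>\<^bsub>B\<^esub> h) = f \<cdot>\<^bsub>B\<^esub> h" "P2 B X Y \<cdot>\<^bsub>B\<^esub> (tuple B f g \<cdot>\<^bsub>B\<^esub> h) = g \<cdot>\<^bsub>B\<^esub> h"
  using assms tuple_simps[OF assms(1-3)]
    comp_assoc_simp[of h "tuple B f g" "P1 B X Y"] comp_assoc_simp[of h "tuple B f g" "P2 B X Y"]
  by auto

lemma times_simps [simp]:
  assumes "f \<in> Arr B" "g \<in> Arr B"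
  shows "times B f g \<in> Arr B" "Dom B (times B f g) = Prod B (Dom B f) (Dom B g)"
    "Cod B (times B f g) = Prod B (Cod B f) (Cod B g)"
    "Cod B f = X \<Longrightarrow> Cod B g = Y \<Longrightarrow> P1 B X Y \<cdot>\<^bsub>B\<^esub> times B f g = f \<cdot>\<^bsub>B\<^esub> P1 B (Dom B f) (Dom B g)"
    "Cod B f = X \<Longrightarrow> Cod B g = Y \<Longrightarrow> P2 B X Y \<cdot>\<^bsub>B\<^esub> times B f g = g \<cdot>\<^bsub>B\<^esub> P2 B (Dom B f) (Dom B g)"
  using assms by (auto simp: times_def)

lemma times_comp_simps [simp]:
  assumes "f \<in> Arr B" "g \<in> Arr B" "Cod B f = X" "Cod B g = Y"
    "h \<in> Arr B" "Cod B h = Prod B (Dom B f) (Dom B g)"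
  shows "P1 B X Y \<cdot>\<^bsub>B\<^esub> (times B f g \<cdot>\<^bsub>B\<^esub> h) = f \<cdot>\<^bsub>B\<^esub> (P1 B (Dom B f) (Dom B g) \<cdot>\<^bsub>B\<^esub> h)"
    "P2 B X Y \<cdot>\<^bsub>B\<^esub> (times B f g \<cdot>\<^bsub>B\<^esub> h) = g \<cdot>\<^bsub>B\<^esub> (P2 B (Dom B f) (Dom B g) \<cdot>\<^bsub>B\<^esub> h)"
  using assms by (auto simp: times_def)

lemma assoc_simps [simp]:
  assumes "X \<in> Obj B" "Y \<in> Obj B" "Z \<in> Obj B"
  shows "assoc B X Y Z \<in> Arr B" "Dom B (assoc B X Y Z) = Prod B (Prod B X Y) Z"
    "Cod B (assoc B X Y Z) = Prod B X (Prod B Y Z)"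
    "P1 B X (Prod B Y Z) \<cdot>\<^bsub>B\<^esub> assoc B X Y Z = P1 B X Y \<cdot>\<^bsub>B\<^esub> P1 B (Prod B X Y) Z"
    "P2 B X (Prod B Y Z) \<cdot>\<^bsub>B\<^esub> assoc B X Y Z =
      tuple B (P2 B X Y \<cdot>\<^bsub>B\<^esub> P1 B (Prod B X Y) Z) (P2 B (Prod B X Y) Z)"
    "h \<in> Arr B \<Longrightarrow> Cod B h = Prod B (Prod B X Y) Z \<Longrightarrow>
      P1 B X (Prod B Y Z) \<cdot>\<^bsub>B\<^esub> (assoc B X Y Z \<cdot>\<^bsub>B\<^esub> h) = P1 B X Y \<cdot>\<^bsub>B\<^esub> (P1 B (Prod B X Y) Z \<cdot>\<^bsub>B\<^esub> h)"
    "h \<in> Arr B \<Longrightarrow> Cod B h = Prod B (Prod B X Y) Z \<Longrightarrow>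
      P2 B X (Prod B Y Z) \<cdot>\<^bsub>B\<^esub> (assoc B X Y Z \<cdot>\<^bsub>B\<^esub> h) =
      tuple B (P2 B X Y \<cdot>\<^bsub>B\<^esub> P1 B (Prod B X Y) Z) (P2 B (Prod B X Y) Z) \<cdot>\<^bsub>B\<^esub> h"
  using assms by (auto simp: assoc_def Let_def)

lemma assoc_inv_simps [simp]:
  assumes "X \<in> Obj B" "Y \<in> Obj B" "Z \<in> Obj B"
  shows "assoc_inv B X Y Z \<in> Arr B" "Dom B (assoc_inv B X Y Z) = Prod B X (Prod B Y Z)"
    "Cod B (assoc_inv B X Y Z) = Prod B (Prod B X Y) Z"
    "P1 B (Prod B X Y) Z \<cdot>\<^bsub>B\<^esub> assoc_inv B X Y Z =
      tuple B (P1 B X (Prod B Y Z)) (P1 B Y Z \<cdot>\<^bsub>B\<^esub> P2 B X (Prod B Y Z))"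
    "P2 B (Prod B X Y) Z \<cdot>\<^bsub>B\<^esub> assoc_inv B X Y Z = P2 B Y Z \<cdot>\<^bsub>B\<^esub> P2 B X (Prod B Y Z)"
    "h \<in> Arr B \<Longrightarrow> Cod B h = Prod B X (Prod B Y Z) \<Longrightarrow>
      P1 B (Prod B X Y) Z \<cdot>\<^bsub>B\<^esub> (assoc_inv B X Y Z \<cdot>\<^bsub>B\<^esub> h) =
      tuple B (P1 B X (Prod B Y Z)) (P1 B Y Z \<cdot>\<^bsub>B\<^esub> P2 B X (Prod B Y Z)) \<cdot>\<^bsub>B\<^esub> h"
    "h \<in> Arr B \<Longrightarrow> Cod B h = Prod B X (Prod B Y Z) \<Longrightarrow>
      P2 B (Prod B X Y) Z \<cdot>\<^bsub>B\<^esub> (assoc_inv B X Y Z \<cdot>\<^bsub>B\<^esub> h) = P2 B Y Z \<cdot>\<^bsub>B\<^esub> (P2 B X (Prod B Y Z) \<cdot>\<^bsub>B\<^esub> h)"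
  using assms by (auto simp: assoc_inv_def Let_def)

lemma symm_simps [simp]:
  assumes "X \<in> Obj B" "Y \<in> Obj B"
  shows "symm B X Y \<in> Arr B" "Dom B (symm B X Y) = Prod B X Y" "Cod B (symm B X Y) = Prod B Y X"
    "P1 B Y X \<cdot>\<^bsub>B\<^esub> symm B X Y = P2 B X Y" "P2 B Y X \<cdot>\<^bsub>B\<^esub> symm B X Y = P1 B X Y"
    "h \<in> Arr B \<Longrightarrow> Cod B h = Prod B X Y \<Longrightarrow> P1 B Y X \<cdot>\<^bsub>B\<^esub> (symm B X Y \<cdot>\<^bsub>B\<^esub> h) = P2 B X Y \<cdot>\<^bsub>B\<^esub> h"
    "h \<in> Arr B \<Longrightarrow> Cod B h = Prod B X Y \<Longrightarrow> P2 B Y X \<cdot>\<^bsub>B\<^esub> (symm B X Y \<cdot>\<^bsub>B\<^esub> h) = P1 B X Y \<cdot>\<^bsub>B\<^esub> h"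
  using assms by (auto simp: symm_def)

section \<open>Functoriality, naturality and coherence of the cartesian constraints in the
  base\<close>

lemma times_Ident: "X \<in> Obj B \<Longrightarrow> Y \<in> Obj B \<Longrightarrow> times B (Ident B X) (Ident B Y) = Ident B (Prod B X Y)"
  by (rule product_ext[of _ _ X Y]) simp_all

lemma times_comp:
  assumes "f \<in> Arr B" "g \<in> Arr B" "f' \<in> Arr B" "g' \<in> Arr B" "Cod B f = Dom B f'" "Cod B g = Dom B g'"
  shows "times B (f' \<cdot>\<^bsub>B\<^esub> f) (g' \<cdot>\<^bsub>B\<^esub> g) = times B f' g' \<cdot>\<^bsub>B\<^esub> times B f g"
  by (rule product_ext[of _ _ "Cod B f'" "Cod B g'"]) (use assms in simp_all)

lemma assoc_natural:
  assumes "f \<in> Arr B" "g \<in> Arr B" "h \<in> Arr B"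
  shows "assoc B (Cod B f) (Cod B g) (Cod B h) \<cdot>\<^bsub>B\<^esub> times B (times B f g) h =
    times B f (times B g h) \<cdot>\<^bsub>B\<^esub> assoc B (Dom B f) (Dom B g) (Dom B h)"
  by (rule product_ext[of _ _ "Cod B f" "Prod B (Cod B g) (Cod B h)"],
      use assms in simp_all, rule product_ext[of _ _ "Cod B g" "Cod B h"]) (use assms in simp_all)

lemma symm_natural:
  assumes "f \<in> Arr B" "g \<in> Arr B"
  shows "symm B (Cod B f) (Cod B g) \<cdot>\<^bsub>B\<^esub> times B f g = times B g f \<cdot>\<^bsub>B\<^esub> symm B (Dom B f) (Dom B g)"
  by (rule product_ext[of _ _ "Cod B g" "Cod B f"]) (use assms in simp_all)

lemma symm_symm: "X \<in> Obj B \<Longrightarrow> Y \<in> Obj B \<Longrightarrow> symm B Y X \<cdot>\<^bsub>B\<^esub> symm B X Y = Ident B (Prod B X Y)"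
  by (rule product_ext[of _ _ X Y]) simp_all

text \<open>Sends the target of \<open>PC\<close> at \<open>assoc_inv\<close> and
  \<open>assoc\<close> to \<open>F\<close> of an identity, where the inverse of \<open>PU\<close> in
  \<open>omega_mate\<close> can be composed.\<close>

lemma assoc_assoc_inv:
  assumes "X \<in> Obj B" "Y \<in> Obj B" "Z \<in> Obj B"
  shows "assoc B X Y Z \<cdot>\<^bsub>B\<^esub> assoc_inv B X Y Z = Ident B (Prod B X (Prod B Y Z))"
  by (rule product_ext[of _ _ X "Prod B Y Z"], use assms in simp_all,
      rule product_ext[of _ _ Y Z]) (use assms in simp_all)

text \<open>Tested on the projections to \<open>X\<close> and \<open>Z\<close>. \<open>Y\<close> is
  arbitrary because the projections replace the unit constraints; the unit axiom uses the case where
  \<open>Y\<close> is \<open>One B\<close>.\<close>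

lemma triangle:
  assumes "X \<in> Obj B" "Y \<in> Obj B" "Z \<in> Obj B"
  shows "times B (Ident B X) (P2 B Y Z) \<cdot>\<^bsub>B\<^esub> assoc B X Y Z = times B (P1 B X Y) (Ident B Z)"
  by (rule product_ext[of _ _ X Z]) (use assms in simp_all)

text \<open>An arrow into the iterated product is determined by its four projections, reached by
  three uses of \<open>product_ext\<close>. The bracketing on the left is that of the target of
  \<open>psf_comp3\<close>; the hexagons follow the same convention.\<close>

lemma pentagon:
  assumes "X \<in> Obj B" "Y \<in> Obj B" "Z \<in> Obj B" "W \<in> Obj B"
  shows "times B (Ident B X) (assoc B Y Z W) \<cdot>\<^bsub>B\<^esub> (assoc B X (Prod B Y Z) W \<cdot>\<^bsub>B\<^esub>
      times B (assoc B X Y Z) (Ident B W)) = assoc B X Y (Prod B Z W) \<cdot>\<^bsub>B\<^esub> assoc B (Prod B X Y) Z W"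
  by (rule product_ext[of _ _ X "Prod B Y (Prod B Z W)"], use assms in simp_all,
      rule product_ext[of _ _ Y "Prod B Z W"], use assms in simp_all,
      rule product_ext[of _ _ Z W], use assms in simp_all)

lemma hexagon:
  assumes "X \<in> Obj B" "Y \<in> Obj B" "Z \<in> Obj B"
  shows "times B (Ident B Y) (symm B X Z) \<cdot>\<^bsub>B\<^esub> (assoc B Y X Z \<cdot>\<^bsub>B\<^esub> times B (symm B X Y) (Ident B Z)) =
    assoc B Y Z X \<cdot>\<^bsub>B\<^esub> (symm B X (Prod B Y Z) \<cdot>\<^bsub>B\<^esub> assoc B X Y Z)"
  by (rule product_ext[of _ _ Y "Prod B Z X"], use assms in simp_all,
      rule product_ext[of _ _ Z X], use assms in simp_all)

lemma hexagon_inv: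
  assumes "X \<in> Obj B" "Y \<in> Obj B" "Z \<in> Obj B"
  shows "times B (symm B X Z) (Ident B Y) \<cdot>\<^bsub>B\<^esub> (assoc_inv B X Z Y \<cdot>\<^bsub>B\<^esub> times B (Ident B X) (symm B Y Z)) =
    assoc_inv B Z X Y \<cdot>\<^bsub>B\<^esub> (symm B (Prod B X Y) Z \<cdot>\<^bsub>B\<^esub> assoc_inv B X Y Z)"
  by (rule product_ext[of _ _ "Prod B Z X" Y], use assms in simp_all,
      rule product_ext[of _ _ Z X], use assms in simp_all)

end

section \<open>The canonical oplax structure\<close>

lemma ftor_eqI: "(\<And>x. FO S x = FO T x) \<Longrightarrow> (\<And>f. FA S f = FA T f) \<Longrightarrow> S = T"
  for S T :: "('o, 'm, 'p, 'n) ftor"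
  by (cases S; cases T) (simp add: fun_eq_iff)

text \<open>Projections in place of pair patterns let such rules rewrite at arguments that are not
  literal pairs.\<close>

lemma prod_ftor_simps [simp]:
  "FO (S \<otimes> T) xy = (FO S (fst xy), FO T (snd xy))" "FA (S \<otimes> T) fg = (FA S (fst fg), FA T (snd fg))"
  by (simp_all add: prod_ftor_def map_prod_def case_prod_unfold)

lemma pair_ftor_simps [simp]:
  "FO (pair_ftor S T) x = (FO S x, FO T x)" "FA (pair_ftor S T) f = (FA S f, FA T f)"
  by (simp_all add: pair_ftor_def)

lemma projection_ftor_simps [simp]:
  "FO fst_ftor xy = fst xy" "FA fst_ftor fg = fst fg"
  "FO snd_ftor xy = snd xy" "FA snd_ftor fg = snd fg"
  "FO swap_ftor xy = (snd xy, fst xy)" "FA swap_ftor fg = (snd fg, fst fg)"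
  by (simp_all add: fst_ftor_def snd_ftor_def swap_ftor_def prod.swap_def)

lemma assoc_ftor_simps [simp]:
  "FO assoc_ftor xyz = (fst (fst xyz), snd (fst xyz), snd xyz)"
  "FA assoc_ftor fgh = (fst (fst fgh), snd (fst fgh), snd fgh)"
  by (simp_all add: assoc_ftor_def case_prod_unfold)

lemma assoc_inv_ftor_simps [simp]:
  "FO assoc_inv_ftor xyz = ((fst xyz, fst (snd xyz)), snd (snd xyz))"
  "FA assoc_inv_ftor fgh = ((fst fgh, fst (snd fgh)), snd (snd fgh))"
  by (simp_all add: assoc_inv_ftor_def case_prod_unfold)

lemma times_ftor_simps [simp]:
  "FO (times_ftor B) XY = Prod B (fst XY) (snd XY)" "FA (times_ftor B) uv = times B (fst uv) (snd uv)"
  by (simp_all add: times_ftor_def case_prod_unfold)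

lemma psf_prod_simps [simp]:
  "PO (psf_prod F G) XY = PO F (fst XY) \<times>\<^sub>C PO G (snd XY)"
  "PA (psf_prod F G) fg = PA F (fst fg) \<otimes> PA G (snd fg)"
  "PC (psf_prod F G) fg hk xy = (PC F (fst fg) (fst hk) (fst xy), PC G (snd fg) (snd hk) (snd xy))"
  "PU (psf_prod F G) XY xy = (PU F (fst XY) (fst xy), PU G (snd XY) (snd xy))"
  by (simp_all add: psf_prod_def case_prod_unfold prod_cell_def map_prod_def)

lemma psf_precomp_simps [simp]:
  "PO (psf_precomp F K) c = PO F (FO K c)" "PA (psf_precomp F K) u = PA F (FA K u)"
  "PC (psf_precomp F K) u v = PC F (FA K u) (FA K v)" "PU (psf_precomp F K) c = PU F (FO K c)"
  by (simp_all add: psf_precomp_def)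

lemma psf_unit_simps [simp]: "PO psf_unit c = unit_cat" "PA psf_unit u = id_ftor"
  by (simp_all add: psf_unit_def)

lemma pnt_precomp_simps [simp]:
  "Fn (pnt_precomp \<tau> K) c = Fn \<tau> (FO K c)" "Cell (pnt_precomp \<tau> K) u = Cell \<tau> (FA K u)"
  by (simp_all add: pnt_precomp_def)

lemma pnt_comp_simps [simp]:
  "Fn (pnt_comp B H \<upsilon> \<tau>) X = Fn \<upsilon> X \<odot> Fn \<tau> X"
  "Cell (pnt_comp B H \<upsilon> \<tau>) u x =
    Cell \<upsilon> u (FO (Fn \<tau> (Dom B u)) x) \<cdot>\<^bsub>PO H (Cod B u)\<^esub> FA (Fn \<upsilon> (Cod B u)) (Cell \<tau> u x)"
  by (simp_all add: pnt_comp_def vcomp_def whisker_left_def whisker_right_def)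

lemma pnt_prod_simps [simp]:
  "Fn (pnt_prod \<sigma> \<tau>) XY = Fn \<sigma> (fst XY) \<otimes> Fn \<tau> (snd XY)"
  "Cell (pnt_prod \<sigma> \<tau>) uv xy = (Cell \<sigma> (fst uv) (fst xy), Cell \<tau> (snd uv) (snd xy))"
  by (simp_all add: pnt_prod_def case_prod_unfold prod_cell_def map_prod_def)

lemma pnt_strict_simps [simp]:
  "Fn (pnt_strict B G T) = T"
  "Cell (pnt_strict B G T) u x = Ident (PO G (Cod B u)) (FO (PA G u) (FO (T (Dom B u)) x))"
  by (simp_all add: pnt_strict_def id_cell_def)

lemma pnt_id_simps [simp]:
  "Fn (pnt_id B F) X = id_ftor" "Cell (pnt_id B F) u x = Ident (PO F (Cod B u)) (FO (PA F u) x)"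
  by (simp_all add: pnt_id_def)

lemma pnt_image_simps [simp]:
  "Fn (pnt_image C B F K K' a) c = PA F (a c)"
  "Cell (pnt_image C B F K K' a) u = psf_square B F (FA K u) (a (Cod C u)) (a (Dom C u)) (FA K' u)"
  by (simp_all add: pnt_image_def)

lemma canonical_L_simps [simp]:
  "Fn (canonical_L B F) XY = pair_ftor (PA F (P1 B (fst XY) (snd XY))) (PA F (P2 B (fst XY) (snd XY)))"
  "Cell (canonical_L B F) uv x =
    (psf_square B F (times B (fst uv) (snd uv)) (P1 B (Cod B (fst uv)) (Cod B (snd uv)))
      (P1 B (Dom B (fst uv)) (Dom B (snd uv))) (fst uv) x,
     psf_square B F (times B (fst uv) (snd uv)) (P2 B (Cod B (fst uv)) (Cod B (snd uv)))
      (P2 B (Dom B (fst uv)) (Dom B (snd uv))) (snd uv) x)"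
  by (simp_all add: canonical_L_def case_prod_unfold pair_cell_def)

lemmas cell_defs = vcomp_def whisker_left_def whisker_right_def id_cell_def inverse_cell_def
  pair_cell_def prod_cell_def psf_square_def psf_comp3_def Let_def

lemma FO_path_ftor_Nil: "FO (path_ftor F []) x = x"
  by simp

text \<open>Read backwards together with the rule for the empty path, it peels one application of
  \<open>FO (PA F f)\<close> off an object at a time until the base point is reached, and so builds
  the path to that object.\<close>

lemma FO_path_ftor_Cons: "FO (path_ftor F p) x = y \<Longrightarrow> FO (path_ftor F (f # p)) x = FO (PA F f) y"
  by simp

section \<open>Verification of the canonical structure\<close>

locale cart_psf = cart B + psf_cat B F
  for B :: "('b, 'a, 'z) cart_cat_scheme" and F :: "('b, 'a, 'o, 'm) psf"
begin

lemma PA_Obj [simp]: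
  "f \<in> Arr B \<Longrightarrow> Cod B f = Y \<Longrightarrow> x \<in> Obj (PO F (Dom B f)) \<Longrightarrow> FO (PA F f) x \<in> Obj (PO F Y)"
  using functor_Obj[OF functor_PA[of f "Dom B f" Y]] by (simp add: hom_iff)

lemma is_functor_PA:
  "f \<in> Arr B \<Longrightarrow> Dom B f = X \<Longrightarrow> Cod B f = Y \<Longrightarrow> is_functor (PO F X) (PO F Y) (PA F f)"
  by (simp add: functor_PA hom_iff)

text \<open>In a \<open>canon\<close> goal both paths are schematic: resolution with these rules reads them off the
  arrow, and the simplifier then only has to compare lists of arrows of the base category.\<close>

lemmas coherence = conjI canon_nat_iso canon_Ident canon_comp canon_FA canon_PC canon_PU
  canon_inverse FO_path_ftor_Nil FO_path_ftor_Cons ftor_eqI is_functor_pair_ftor is_functor_PA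

text \<open>The unit and composition laws equate canonical arrows. Their end paths agree because the
  product functor of the base preserves identities and composites.\<close>

lemma pseudonatural_canonical_L:
  "pseudonatural (B \<times>\<^sub>C B) (psf_precomp F (times_ftor B)) (psf_prod F F) (canonical_L B F)"
  unfolding pseudonatural_def cells_eq_def prod_cat_simps split_paired_Ball_Sigma Let_def
  \<comment> \<open>The first phase evaluates both sides to composites of constraint components in
    the factors. The loop then derives canonicity along the syntax of these arrows and leaves
    comparisons of paths to rewriting. \<open>canon_unique\<close> comes last, for an equation of
    arrows that rewriting does not close. The other verifications follow this pattern.\<close>
  by (intro conjI ballI impI; simp add: cell_defs nat_iso_prod_cat)
    ((assumption | rule coherence | (simp add: times_Ident times_comp; fail) | rule canon_unique)+)

text \<open>All conditions concern cells of the terminal category, which has a single object and a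
  single arrow.\<close>

lemma pseudonatural_canonical_L1:
  "pseudonatural unit_cat (psf_precomp F (pick_one B)) psf_unit canonical_L1"
  by (auto simp: pseudonatural_def canonical_L1_def unit_cat_def is_functor_def hom_iff
      nat_iso_def nat_trans_def is_iso_def is_inverse_def cells_eq_def Let_def)

text \<open>Each projection of the modification square equates canonical arrows; their paths match
  by naturality of the associator in the base.\<close>

lemma invertible_modification_omega:
  "invertible_modification ((B \<times>\<^sub>C B) \<times>\<^sub>C B) (omega_dom B F) (omega_cod F)
    (omega_source B F (canonical_L B F)) (omega_target B F (canonical_L B F)) (canonical_omega B F)"
  unfolding invertible_modification_def cells_eq_def prod_cat_simps split_paired_Ball_Sigma Let_def
    omega_dom_def omega_cod_def omega_source_def omega_target_def canonical_omega_def
  by (intro conjI ballI impI; simp add: cell_defs nat_iso_prod_cat)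
    ((assumption | rule coherence | (simp add: assoc_natural; fail) | rule canon_unique)+)

lemma invertible_modification_theta:
  "invertible_modification (B \<times>\<^sub>C B) (psf_precomp F (times_ftor B)) (theta_cod F)
    (theta_source B F (canonical_L B F)) (theta_target B F (canonical_L B F)) (canonical_theta B F)"
  unfolding invertible_modification_def cells_eq_def prod_cat_simps split_paired_Ball_Sigma Let_def
    theta_cod_def theta_source_def theta_target_def canonical_theta_def
  by (intro conjI ballI impI; simp add: cell_defs nat_iso_prod_cat)
    ((assumption | rule coherence | (simp add: symm_natural; fail) | rule canon_unique)+)

text \<open>Source and target have the same functors as components, hence identity cells suffice.
  Both 2-cells at \<open>u\<close> are the canonical isomorphism of one commutative square, the
  naturality square of the first projection. \<open>xi\<close> is the mirror image.\<close>

lemma invertible_modification_zeta: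
  "invertible_modification B (zeta_dom B F) F (zeta_source B F)
    (zeta_target B F (canonical_L B F) canonical_L1) (canonical_zeta B F)"
  unfolding invertible_modification_def cells_eq_def prod_cat_simps split_paired_Ball_Sigma Let_def
    zeta_dom_def zeta_source_def zeta_target_def canonical_zeta_def canonical_L1_def
  by (intro conjI ballI impI; simp add: cell_defs nat_iso_prod_cat with_one_def pick_one_def)
    ((assumption | rule coherence | (simp; fail) | rule canon_unique)+)

lemma invertible_modification_xi:
  "invertible_modification B (xi_dom B F) F (xi_source B F)
    (xi_target B F (canonical_L B F) canonical_L1) (canonical_xi B F)"
  unfolding invertible_modification_def cells_eq_def prod_cat_simps split_paired_Ball_Sigma Let_def
    xi_dom_def xi_source_def xi_target_def canonical_xi_def canonical_L1_def
  by (intro conjI ballI impI; simp add: cell_defs nat_iso_prod_cat one_with_def pick_one_def)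
    ((assumption | rule coherence | (simp; fail) | rule canon_unique)+)

section \<open>The coherence axioms\<close>

lemma axiom_assoc_canonical: "axiom_assoc B F (canonical_L B F) (canonical_omega B F)"
  unfolding axiom_assoc_def cells_eq_def Let_def canonical_omega_def cell_l_def cell_r_def
  \<comment> \<open>In every factor both pastings are canonical. The pentagon identifies the
    composite reached by \<open>PC F b1 b2\<close> with the one at which the inverse of
    \<open>psf_comp3\<close> starts.\<close>
  by (intro ballI; simp add: cell_defs)
    ((assumption | rule coherence | (simp add: pentagon; fail) | rule canon_unique)+)

lemma axiom_unit_canonical:
  "axiom_unit B F (canonical_L B F) canonical_L1 (canonical_omega B F) (canonical_zeta B F) (canonical_xi B F)"
  unfolding axiom_unit_def cells_eq_def Let_def canonical_omega_def cell_l_def cell_r_def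
    canonical_zeta_def canonical_xi_def canonical_L1_def
  by (intro ballI; simp add: cell_defs)
    ((assumption | rule coherence | (simp add: triangle; fail) | rule canon_unique)+)

lemma axiom_braid1_canonical:
  "axiom_braid1 B F (canonical_L B F) (canonical_omega B F) (canonical_theta B F)"
  unfolding axiom_braid1_def cells_eq_def Let_def canonical_omega_def canonical_theta_def cell_l_def cell_r_def
  by (intro ballI; simp add: cell_defs)
    ((assumption | rule coherence | (simp add: hexagon; fail) | rule canon_unique)+)

lemma axiom_symm_canonical: "axiom_symm B F (canonical_L B F) (canonical_theta B F)"
  unfolding axiom_symm_def cells_eq_def Let_def canonical_theta_def
  by (intro ballI; simp add: cell_defs)
    ((assumption | rule coherence | (simp add: symm_symm; fail) | rule canon_unique)+)

text \<open>\<open>omega_mate\<close> inverts \<open>omega\<close> in a threefold product, whereas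
  canonical arrows live in the factors. The inverse splits because \<open>omega\<close> is already
  known to be invertible as a modification.\<close>

lemma inverse_arr_canonical_omega:
  assumes XYZ: "X \<in> Obj B" "Y \<in> Obj B" "Z \<in> Obj B" and x: "x \<in> Obj (PO F (Prod B (Prod B X Y) Z))"
  shows "inverse_arr (PO F X \<times>\<^sub>C PO F Y \<times>\<^sub>C PO F Z) (canonical_omega B F ((X, Y), Z) x) =
    (inverse_arr (PO F X) (fst (canonical_omega B F ((X, Y), Z) x)),
     inverse_arr (PO F Y) (fst (snd (canonical_omega B F ((X, Y), Z) x))),
     inverse_arr (PO F Z) (snd (snd (canonical_omega B F ((X, Y), Z) x))))"
proof -
  have "is_iso (PO F X \<times>\<^sub>C PO F Y \<times>\<^sub>C PO F Z) (canonical_omega B F ((X, Y), Z) x)"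
    using invertible_modification_omega XYZ x
    by (auto simp: invertible_modification_def nat_iso_def omega_dom_def omega_cod_def)
  then show ?thesis
    \<comment> \<open>The case split presents the value of \<open>omega\<close> as an explicit
      triple, as the splitting of inverses in a product requires.\<close>
    using XYZ by (cases "canonical_omega B F ((X, Y), Z) x")
      (simp add: is_iso_prod_cat inverse_arr_prod_cat category_prod_cat category_PO)
qed

lemma axiom_braid2_canonical:
  "axiom_braid2 B F (canonical_L B F) (canonical_omega B F) (canonical_theta B F)"
  unfolding axiom_braid2_def cells_eq_def Let_def omega_mate_def canonical_theta_def cell_l_def cell_r_def
  \<comment> \<open>Two rounds: the inverse of \<open>omega\<close> is split while
    \<open>canonical_omega\<close> is still folded and can be matched, and only then are its
    components unfolded.\<close>
  by (intro ballI; simp add: cell_defs inverse_arr_canonical_omega; simp add: cell_defs canonical_omega_def)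
    ((assumption | rule coherence | (simp add: hexagon_inv assoc_assoc_inv; fail) | rule canon_unique)+)

end

theorem proposition3p4:
  fixes B :: "('b, 'a) cart_cat" and F :: "('b, 'a, 'o, 'm) psf"
  assumes "cartesian B"
    and "pseudofunctor B F"
  shows "oplax_symmetric_monoidal B F (canonical_L B F) canonical_L1
    (canonical_omega B F) (canonical_zeta B F) (canonical_xi B F) (canonical_theta B F)"
proof -
  interpret cart_psf B F
    by unfold_locales (use assms in \<open>auto simp: cartesian_def\<close>)
  show ?thesis
    unfolding oplax_symmetric_monoidal_def
    by (intro conjI pseudonatural_canonical_L pseudonatural_canonical_L1 invertible_modification_omega
        invertible_modification_zeta invertible_modification_xi invertible_modification_theta
        axiom_assoc_canonical axiom_unit_canonical axiom_braid1_canonical axiom_braid2_canonical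
        axiom_symm_canonical)
qed

end
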